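(* Let $\mathcal{G}$ be a kernel weighted timed game with exactly two clocks. Then for every location $i$ of $\mathcal{G}$, the function $W_i:\nu\mapsto\mathsf{Val}_{\mathcal{G}}(i,\nu)$ (on $\mathsf{reg}(i)$) is a continuous piecewise-linear function, and it can be computed by the value iteration algorithm: there is $k\in\mathbb{N}$ such that $\mathsf{opt}^{k+1}_\ell=\mathsf{opt}^k_\ell$ for every location $\ell$, and then $\mathsf{opt}^k_i=W_i$.
   Context: Weighted timed games (WTGs) $(L_{\mathsf{Min}},L_{\mathsf{Max}},G,\mathcal{X},T,w)$ are turn-based two-player games: disjoint finite location sets of $\mathsf{Min}$ and $\mathsf{Max}$, goal locations $G\subseteq L_{\mathsf{Min}}$, finite clock set $\mathcal{X}$, finite transitions $\ell\xrightarrow{C,X}\ell'$ with $C$ a set of clock constraints $x\sim n$ ($n\in\mathbb{N}$, ${\sim}\in\{<,\le,=,\ge,>\}$) and $X\subseteq\mathcal{X}$ the reset clocks. A delayed transition $(\ell,\nu)\xrightarrow{d,t}(\ell',\nu')$ with $d\ge0$ requires $\nu+d\models C$ and $\nu'=(\nu+d)[X:=0]$. Plays are maximal runs, strategies choose (delay, transition) in own locations, infinite plays have weight $+\infty$, and the value $\mathsf{Val}_{\mathcal{G}}(\ell,\nu)$ is $\inf_{\sigma_{\mathsf{Min}}}\sup_{\sigma_{\mathsf{Max}}}$ of the play weight (games are determined). A kernel WTG is a WTG in which every reachable configuration has all clock values in $[0,1]$, every location and transition has weight $0$, each location $\ell$ is associated with a clock region $\mathsf{reg}(\ell)$ containing the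 valuations with which $\ell$ can be visited, and each goal location $\ell$ carries a continuous piecewise-linear output function $w_{\mathsf{out}}(\ell,\cdot):\mathsf{reg}(\ell)\to\mathbb{R}$; the weight of a play ending in goal configuration $(\ell,\nu)$ is $w_{\mathsf{out}}(\ell,\nu)$. Values are assumed to be real. Value iteration: $\mathsf{opt}^0_\ell=w_{\mathsf{out}}(\ell,\cdot)$ if $\ell\in G$ and the constant $+\infty$ otherwise; for $k\ge0$ and $\ell\in L_{\mathsf{Min}}$ (resp. $L_{\mathsf{Max}}$), $\mathsf{opt}^{k+1}_\ell(\nu)=\inf$ (resp. $\sup$) of $\{\mathsf{opt}^k_{\ell'}((\nu+\delta)[X:=0]) : \ell\xrightarrow{C,X}\ell'\in T,\ \delta\ge0,\ \nu+\delta\models C\}$.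
   Formalization: Plays stop at the first goal, and goal locations keep opt^k = w_out for every k; read literally, the recursion on L_Min gives opt^1 = inf ∅ = +∞ at a goal without outgoing transitions, so the stable iterate would not equal the value. *)

theory Defs
  imports "HOL-Analysis.Analysis"
begin

text \<open>Clocks are the elements of a finite type, so a clock valuation is a vector.\<close>

type_synonym 'c valuation = "real ^ 'c"

datatype cmp = Lt | Le | Eq | Ge | Gt

fun cmp_holds :: "cmp \<Rightarrow> real \<Rightarrow> real \<Rightarrow> bool" where
  "cmp_holds Lt a b \<longleftrightarrow> a < b"
| "cmp_holds Le a b \<longleftrightarrow> a \<le> b"
| "cmp_holds Eq a b \<longleftrightarrow> a = b"
| "cmp_holds Ge a b \<longleftrightarrow> a \<ge> b"
| "cmp_holds Gt a b \<longleftrightarrow> a > b"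

type_synonym 'c clock_constraint = "'c \<times> cmp \<times> nat"

definition satisfies :: "'c::finite valuation \<Rightarrow> 'c clock_constraint set \<Rightarrow> bool" where
  "satisfies \<nu> C \<longleftrightarrow> (\<forall>(x, r, n) \<in> C. cmp_holds r (\<nu> $ x) (real n))"

definition delay :: "'c::finite valuation \<Rightarrow> real \<Rightarrow> 'c valuation" where
  "delay \<nu> d = (\<chi> x. \<nu> $ x + d)"

definition reset :: "'c set \<Rightarrow> 'c::finite valuation \<Rightarrow> 'c valuation" where
  "reset X \<nu> = (\<chi> x. if x \<in> X then 0 else \<nu> $ x)"

datatype ('l, 'c) transition =
  Transition (source: 'l) (guard: "'c clock_constraint set") (resets: "'c set") (target: 'l)

record ('l, 'c) wtg =
  min_locs :: "'l set"
  max_locs :: "'l set"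
  goals :: "'l set"
  transitions :: "('l, 'c) transition set"
  loc_weight :: "'l \<Rightarrow> int"
  trans_weight :: "('l, 'c) transition \<Rightarrow> int"

definition locs :: "('l, 'c, 'z) wtg_scheme \<Rightarrow> 'l set" where
  "locs G = min_locs G \<union> max_locs G"

definition is_wtg :: "('l, 'c::finite, 'z) wtg_scheme \<Rightarrow> bool" where
  "is_wtg G \<longleftrightarrow>
     finite (min_locs G) \<and> finite (max_locs G) \<and> min_locs G \<inter> max_locs G = {} \<and>
     goals G \<subseteq> min_locs G \<and> finite (transitions G) \<and>
     (\<forall>t \<in> transitions G. source t \<in> locs G \<and> target t \<in> locs G)"

type_synonym ('l, 'c) config = "'l \<times> 'c valuation"
type_synonym ('l, 'c) move = "real \<times> ('l, 'c) transition"
type_synonym ('l, 'c) run = "('l, 'c) config \<times> (('l, 'c) move \<times> ('l, 'c) config) list"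
type_synonym ('l, 'c) strategy = "('l, 'c) run \<Rightarrow> ('l, 'c) move"

definition after :: "('l, 'c::finite) move \<Rightarrow> 'c valuation \<Rightarrow> 'c valuation" where
  "after m \<nu> = (case m of (d, t) \<Rightarrow> reset (resets t) (delay \<nu> d))"

text \<open>The game stops at the first visit to a goal location, so no move is available there.\<close>

definition moves :: "('l, 'c::finite, 'z) wtg_scheme \<Rightarrow> ('l, 'c) config \<Rightarrow> ('l, 'c) move set" where
  "moves G = (\<lambda>(l, \<nu>). {(d, t). l \<notin> goals G \<and> t \<in> transitions G \<and> source t = l \<and>
                               d \<ge> 0 \<and> satisfies (delay \<nu> d) (guard t)})"

definition successor :: "('l, 'c::finite) config \<Rightarrow> ('l, 'c) move \<Rightarrow> ('l, 'c) config" where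
  "successor c m = (target (snd m), after m (snd c))"

definition last_config :: "('l, 'c::finite) run \<Rightarrow> ('l, 'c) config" where
  "last_config \<rho> = (if snd \<rho> = [] then fst \<rho> else snd (last (snd \<rho>)))"

definition extend :: "('l, 'c::finite) run \<Rightarrow> ('l, 'c) move \<Rightarrow> ('l, 'c) run" where
  "extend \<rho> m = (fst \<rho>, snd \<rho> @ [(m, successor (last_config \<rho>) m)])"

inductive_set runs :: "('l, 'c::finite, 'z) wtg_scheme \<Rightarrow> ('l, 'c) run set"
  for G :: "('l, 'c::finite, 'z) wtg_scheme" where
  start: "l \<in> locs G \<Longrightarrow> ((l, \<nu>), []) \<in> runs G"
| step: "\<rho> \<in> runs G \<Longrightarrow> m \<in> moves G (last_config \<rho>) \<Longrightarrow> extend \<rho> m \<in> runs G"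

definition strategies ::
    "('l, 'c::finite, 'z) wtg_scheme \<Rightarrow> 'l set \<Rightarrow> ('l, 'c) strategy set" where
  "strategies G A = {\<sigma>. \<forall>\<rho> \<in> runs G. fst (last_config \<rho>) \<in> A \<and> moves G (last_config \<rho>) \<noteq> {}
                          \<longrightarrow> \<sigma> \<rho> \<in> moves G (last_config \<rho>)}"

definition min_strategies :: "('l, 'c::finite, 'z) wtg_scheme \<Rightarrow> ('l, 'c) strategy set" where
  "min_strategies G = strategies G (min_locs G)"

definition max_strategies :: "('l, 'c::finite, 'z) wtg_scheme \<Rightarrow> ('l, 'c) strategy set" where
  "max_strategies G = strategies G (max_locs G)"

text \<open>\<open>play_prefix G \<sigma> \<tau> c n\<close> consists of the first \<open>n\<close> steps of the maximal run from \<open>c\<close> in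
  which Min follows \<open>\<sigma>\<close> and Max follows \<open>\<tau>\<close>; it is constant in \<open>n\<close> once no move is available.\<close>

primrec play_prefix ::
    "('l, 'c::finite, 'z) wtg_scheme \<Rightarrow> ('l, 'c) strategy \<Rightarrow> ('l, 'c) strategy \<Rightarrow>
     ('l, 'c) config \<Rightarrow> nat \<Rightarrow> ('l, 'c) run" where
  "play_prefix G \<sigma> \<tau> c 0 = (c, [])"
| "play_prefix G \<sigma> \<tau> c (Suc n) =
     (let \<rho> = play_prefix G \<sigma> \<tau> c n in
      if moves G (last_config \<rho>) = {} then \<rho>
      else extend \<rho> (if fst (last_config \<rho>) \<in> min_locs G then \<sigma> \<rho> else \<tau> \<rho>))"

definition accumulated_weight ::
    "('l, 'c::finite, 'z) wtg_scheme \<Rightarrow> ('l, 'c) run \<Rightarrow> real" where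
  "accumulated_weight G \<rho> =
     (\<Sum>((d, t), _) \<leftarrow> snd \<rho>. d * of_int (loc_weight G (source t)) + of_int (trans_weight G t))"

text \<open>The usual region equivalence without a maximal constant: for valuations with all clocks in
  \<open>[0,1]\<close>, the only ones used below, it agrees with the equivalence for maximal constant 1.\<close>

definition region_equiv :: "'c::finite valuation \<Rightarrow> 'c valuation \<Rightarrow> bool" where
  "region_equiv \<nu> \<nu>' \<longleftrightarrow>
     (\<forall>x. \<lfloor>\<nu> $ x\<rfloor> = \<lfloor>\<nu>' $ x\<rfloor> \<and> (frac (\<nu> $ x) = 0 \<longleftrightarrow> frac (\<nu>' $ x) = 0)) \<and>
     (\<forall>x y. frac (\<nu> $ x) \<le> frac (\<nu> $ y) \<longleftrightarrow> frac (\<nu>' $ x) \<le> frac (\<nu>' $ y))"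

definition clock_region :: "'c::finite valuation set \<Rightarrow> bool" where
  "clock_region R \<longleftrightarrow> (\<exists>\<nu>. (\<forall>x. 0 \<le> \<nu> $ x) \<and> R = {\<nu>'. region_equiv \<nu> \<nu>'})"

text \<open>As usual for piecewise-linear functions, the pieces are affine and finite in number. The
  polyhedra are closed, whereas \<open>R\<close> need not be.\<close>

definition continuous_piecewise_linear_on ::
    "'a::euclidean_space set \<Rightarrow> ('a \<Rightarrow> real) \<Rightarrow> bool" where
  "continuous_piecewise_linear_on R f \<longleftrightarrow>
     continuous_on R f \<and>
     (\<exists>\<P>. finite \<P> \<and> R \<subseteq> \<Union>\<P> \<and>
        (\<forall>P \<in> \<P>. polyhedron P \<and> (\<exists>a b. \<forall>v \<in> P \<inter> R. f v = a \<bullet> v + b)))"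

record ('l, 'c::finite) kernel = "('l, 'c) wtg" +
  reg :: "'l \<Rightarrow> 'c valuation set"
  w_out :: "'l \<Rightarrow> 'c valuation \<Rightarrow> real"

text \<open>Every configuration whose valuation lies in the region of its location may be initial.\<close>

definition reachable :: "('l, 'c::finite) kernel \<Rightarrow> ('l, 'c) config set" where
  "reachable K = {last_config \<rho> | \<rho>. \<rho> \<in> runs K \<and> snd (fst \<rho>) \<in> reg K (fst (fst \<rho>))}"

definition kernel_wtg :: "('l, 'c::finite) kernel \<Rightarrow> bool" where
  "kernel_wtg K \<longleftrightarrow>
     is_wtg K \<and>
     (\<forall>l \<in> locs K. loc_weight K l = 0) \<and>
     (\<forall>t \<in> transitions K. trans_weight K t = 0) \<and>
     (\<forall>l \<in> locs K. clock_region (reg K l)) \<and>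
     (\<forall>(l, \<nu>) \<in> reachable K. (\<forall>x. 0 \<le> \<nu> $ x \<and> \<nu> $ x \<le> 1) \<and> \<nu> \<in> reg K l) \<and>
     (\<forall>l \<in> goals K. continuous_piecewise_linear_on (reg K l) (w_out K l))"

text \<open>A play reaching a goal stops there, so the goal prefix below is unique. All other plays
  (infinite, or blocked outside the goals) have weight \<open>\<infinity>\<close>.\<close>

definition play_weight ::
    "('l, 'c::finite) kernel \<Rightarrow> ('l, 'c) strategy \<Rightarrow> ('l, 'c) strategy \<Rightarrow> ('l, 'c) config \<Rightarrow> ereal" where
  "play_weight K \<sigma> \<tau> c =
     (if \<exists>n. fst (last_config (play_prefix K \<sigma> \<tau> c n)) \<in> goals K
      then let \<rho> = play_prefix K \<sigma> \<tau> c (LEAST n. fst (last_config (play_prefix K \<sigma> \<tau> c n)) \<in> goals K);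
               (l, \<nu>) = last_config \<rho>
           in ereal (accumulated_weight K \<rho> + w_out K l \<nu>)
      else \<infinity>)"

definition Val :: "('l, 'c::finite) kernel \<Rightarrow> 'l \<Rightarrow> 'c valuation \<Rightarrow> ereal" where
  "Val K l \<nu> =
     (INF \<sigma> \<in> min_strategies K. SUP \<tau> \<in> max_strategies K. play_weight K \<sigma> \<tau> (l, \<nu>))"

text \<open>Goal locations keep their output function in every iteration.\<close>

primrec opt :: "('l, 'c::finite) kernel \<Rightarrow> nat \<Rightarrow> 'l \<Rightarrow> 'c valuation \<Rightarrow> ereal" where
  "opt K 0 = (\<lambda>l \<nu>. if l \<in> goals K then ereal (w_out K l \<nu>) else \<infinity>)"
| "opt K (Suc k) = (\<lambda>l \<nu>.
     if l \<in> goals K then ereal (w_out K l \<nu>)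
     else if l \<in> min_locs K
       then INF m \<in> moves K (l, \<nu>). opt K k (target (snd m)) (after m \<nu>)
       else SUP m \<in> moves K (l, \<nu>). opt K k (target (snd m)) (after m \<nu>))"

definition value_iteration_stable :: "('l, 'c::finite) kernel \<Rightarrow> nat \<Rightarrow> bool" where
  "value_iteration_stable K k \<longleftrightarrow>
     (\<forall>l \<in> locs K. \<forall>\<nu> \<in> reg K l. opt K (Suc k) l \<nu> = opt K k l \<nu>)"

end

theory Submission
  imports Defs
begin

text \<open>The iterates of \<open>opt\<close> decrease. A stable iterate equals the value by the usual
  threshold strategies, so the point is that the iterates range over a finite set of functions.
  Region equivalence is a bisimulation that moves successors only by a bounded multiple of the
  distance, so every iterate is either constantly \<open>\<infinity>\<close> or Lipschitz on its region. A continuous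
  function that everywhere agrees with some member of a fixed finite set of affine functions is
  determined by one choice for each sign pattern of their differences; hence there are only finitely
  many of them, and each is piecewise linear.

  It remains to find such a finite set. Along a delay, an infimum or supremum is attained at an end of
  the guard interval, where some clock is integral unless the delay is \<open>0\<close>, or at a crossing of two
  affine pieces. After a reset of one clock only one coordinate survives, and a crossing there is one of
  finitely many constants. Without a reset the motion is diagonal; a non-goal iterate is monotone
  along delays, so new crossings arise only from the goal functions, and these are fixed in
  advance. With two clocks, an integral clock leaves one coordinate, \<open>n + \<nu>\<^sub>z - \<nu>\<^sub>x\<close>, of the
  valuation, so all remaining functions are functions of one real parameter that is only copied or
  reflected.\<close>

section \<open>Continuous selections of finitely many affine functions\<close>

text \<open>The danger is that every iteration cuts the pieces anew at crossings of the previous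
  ones, and that crossings of crossings never close up. For this reason no partition is tracked. The
  invariant is pointwise: the value of an iterate at \<open>v\<close> is \<infinity> or lies in the
  set \<open>cands G U v\<close>, with \<open>G\<close> and \<open>U\<close> fixed before the
  iteration starts. Continuity comes separately, from a Lipschitz bound whose constant may grow with
  the number of iterations. The two facts meet in \<open>selection\<close>, which restores the
  pieces.

  One generation of crossings suffices. \<open>G\<close> has to cover only crossings among the
  pieces of one goal function, and in \<open>U\<close> a crossing adds a constant, while a crossing
  with a constant adds nothing new.

  Guards may be strict, so extrema over delays are often only approached; hence the closures and
  closed graphs. Finiteness of the values rules out deadlocks outside the goals, where an empty
  supremum would be -\<infinity> although the play weighs +\<infinity>.\<close>

definition affine_fn :: "('a::euclidean_space \<Rightarrow> real) \<Rightarrow> bool" where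
  "affine_fn g \<longleftrightarrow> (\<exists>a b. \<forall>v. g v = a \<bullet> v + b)"

definition selection :: "'a::euclidean_space set \<Rightarrow> ('a \<Rightarrow> real) set \<Rightarrow> ('a \<Rightarrow> real) \<Rightarrow> bool" where
  "selection R G f \<longleftrightarrow> continuous_on R f \<and> (\<forall>v\<in>R. \<exists>g\<in>G. f v = g v)"

lemma affine_fn_continuous: "affine_fn g \<Longrightarrow> continuous_on S g"
proof -
  assume "affine_fn g"
  then obtain a b where "g = (\<lambda>v. a \<bullet> v + b)" unfolding affine_fn_def by blast
  then show ?thesis by (auto intro!: continuous_intros)
qed

lemma affine_fn_segment:
  assumes "affine_fn g" shows "g ((1 - t) *\<^sub>R v + t *\<^sub>R w) = (1 - t) * g v + t * g w"
proof -
  obtain a b where "\<And>v. g v = a \<bullet> v + b" using assms unfolding affine_fn_def by blast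
  then show ?thesis by (simp add: inner_add_right algebra_simps)
qed

lemma affine_fn_const [simp]: "affine_fn (\<lambda>_. c)"
  unfolding affine_fn_def by (rule exI[of _ 0]) auto

lemma affine_fn_minus: "affine_fn g \<Longrightarrow> affine_fn (\<lambda>v. - g v)"
  unfolding affine_fn_def by (metis inner_minus_left minus_add_distrib)

text \<open>Along the segment from \<open>v\<close> to \<open>w\<close>, an affine difference with
  the same strict sign at both ends keeps it, and one vanishing at both ends vanishes throughout. So
  the closed sets where \<open>f\<close> agrees with \<open>g\<close>, and where it agrees with some
  member differing from \<open>g\<close> at \<open>v\<close>, are disjoint and cover the segment;
  connectedness leaves only the first.\<close>

lemma selection_same_signs:
  assumes R: "convex R" and G: "finite G" "\<And>g. g \<in> G \<Longrightarrow> affine_fn g" and f: "selection R G f"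
    and v: "v \<in> R" and w: "w \<in> R"
    and sg: "\<And>g h. g \<in> G \<Longrightarrow> h \<in> G \<Longrightarrow> g v < h v \<longleftrightarrow> g w < h w"
    and g: "g \<in> G" "f v = g v"
  shows "f w = g w"
proof -
  define S where "S = closed_segment v w"
  have SR: "S \<subseteq> R" unfolding S_def using R v w by (simp add: closed_segment_subset)
  have cf: "continuous_on S f" using f SR unfolding selection_def using continuous_on_subset by blast
  have cl: "closed {z\<in>S. f z = h z}" if "h \<in> G" for h
  proof -
    have "closed (S \<inter> (\<lambda>z. f z - h z) -` {0})"
      by (intro continuous_closed_preimage continuous_on_diff cf affine_fn_continuous[OF G(2)[OF that]])
         (auto simp: S_def)
    moreover have "S \<inter> (\<lambda>z. f z - h z) -` {0} = {z\<in>S. f z = h z}" by auto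
    ultimately show ?thesis by simp
  qed
  have lt: "a z < b z" if "z \<in> S" "a \<in> G" "b \<in> G" "a v < b v" for a b z
  proof -
    obtain t where t: "0 \<le> t" "t \<le> 1" "z = (1 - t) *\<^sub>R v + t *\<^sub>R w"
      using \<open>z \<in> S\<close> unfolding S_def closed_segment_def by auto
    have "a w < b w" using sg that by blast
    then have "(1 - t) * a v + t * a w < (1 - t) * b v + t * b w"
      using \<open>a v < b v\<close> t(1,2)
      by (cases "t = 0") (auto intro!: add_le_less_mono mult_left_mono)
    then show ?thesis using t G that by (simp add: affine_fn_segment)
  qed
  have ne: "a z \<noteq> g z" if "z \<in> S" "a \<in> G" "a v \<noteq> g v" for a z
    using lt[OF that(1,2) g(1)] lt[OF that(1) g(1) that(2)] that(3) by linarith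
  have eq: "a z = g z" if "z \<in> S" "a \<in> G" "a v = g v" for a z
  proof -
    obtain t where t: "0 \<le> t" "t \<le> 1" "z = (1 - t) *\<^sub>R v + t *\<^sub>R w"
      using \<open>z \<in> S\<close> unfolding S_def closed_segment_def by auto
    have "a w = g w" using sg[OF that(2) g(1)] sg[OF g(1) that(2)] that(3) by linarith
    then show ?thesis using t G that g by (simp add: affine_fn_segment)
  qed
  define A where "A = {z\<in>S. f z = g z}"
  define B where "B = (\<Union>h\<in>{h\<in>G. h v \<noteq> g v}. {z\<in>S. f z = h z})"
  have "closed A" unfolding A_def using cl g by blast
  moreover have "closed B" unfolding B_def using cl G(1) by (intro closed_UN) auto
  moreover have "S \<subseteq> A \<union> B"
  proof
    fix z assume z: "z \<in> S"
    then obtain h where "h \<in> G" "f z = h z" using f SR unfolding selection_def by blast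
    then show "z \<in> A \<union> B" using eq[OF z] z unfolding A_def B_def by (cases "h v = g v") auto
  qed
  moreover have "A \<inter> B \<inter> S = {}" using ne unfolding A_def B_def by force
  moreover have "v \<in> A \<inter> S" unfolding A_def S_def using g by auto
  moreover have "connected S" unfolding S_def by simp
  ultimately have "B \<inter> S = {}" unfolding connected_closed by blast
  moreover have "w \<in> S" unfolding S_def by simp
  ultimately have "w \<in> A" using \<open>S \<subseteq> A \<union> B\<close> by blast
  then show ?thesis unfolding A_def by simp
qed

definition signs :: "('a \<Rightarrow> real) set \<Rightarrow> 'a \<Rightarrow> (('a \<Rightarrow> real) \<times> ('a \<Rightarrow> real)) set" where
  "signs G v = {(g, h) \<in> G \<times> G. g v < h v}"

lemma signs_eqD: "signs G v = signs G w \<Longrightarrow> g \<in> G \<Longrightarrow> h \<in> G \<Longrightarrow> g v < h v \<longleftrightarrow> g w < h w"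
  unfolding signs_def by (auto simp: set_eq_iff)

lemma finite_signs: "finite G \<Longrightarrow> finite (signs G ` R)"
  by (rule finite_subset[of _ "Pow (G \<times> G)"]) (auto simp: signs_def)

text \<open>A selection is encoded by a function from sign patterns to \<open>G\<close>. Restriction
  to \<open>R\<close> is what makes the count finite, since \<open>selection\<close> leaves the
  values outside \<open>R\<close> free.\<close>

lemma finite_selections:
  assumes R: "convex R" and G: "finite G" "\<And>g. g \<in> G \<Longrightarrow> affine_fn g"
  shows "finite {restrict f R | f. selection R G f}"
proof -
  define F where "F = PiE (signs G ` R) (\<lambda>_. G)"
  have "finite F" unfolding F_def using G by (intro finite_PiE finite_signs) auto
  moreover have "{restrict f R | f. selection R G f} \<subseteq> (\<lambda>c. restrict (\<lambda>v. c (signs G v) v) R) ` F"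
  proof
    fix x assume "x \<in> {restrict f R | f. selection R G f}"
    then obtain f where f: "selection R G f" "x = restrict f R" by auto
    \<comment> \<open>A pattern gets the member used at one arbitrary point with that pattern; by
      \<open>selection_same_signs\<close> this member serves all other points of the
      pattern.\<close>
    define c where "c = restrict (\<lambda>s. SOME g. g \<in> G \<and> (\<exists>v\<in>R. signs G v = s \<and> f v = g v)) (signs G ` R)"
    have c: "c (signs G v) \<in> G \<and> (\<exists>w\<in>R. signs G w = signs G v \<and> f w = c (signs G v) w)" if "v \<in> R" for v
    proof -
      have "\<exists>g. g \<in> G \<and> (\<exists>w\<in>R. signs G w = signs G v \<and> f w = g w)"
        using f that unfolding selection_def by blast
      from someI_ex[OF this] show ?thesis using that unfolding c_def by auto
    qed
    have "f v = c (signs G v) v" if "v \<in> R" for v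
    proof -
      obtain w where w: "w \<in> R" "signs G w = signs G v" "f w = c (signs G v) w" using c \<open>v \<in> R\<close> by blast
      show ?thesis
        by (rule selection_same_signs[OF R G f(1) w(1) that]) (use signs_eqD[OF w(2)] c that w in auto)
    qed
    moreover have "c \<in> F" unfolding F_def using c by (auto simp: c_def PiE_iff)
    ultimately show "x \<in> (\<lambda>c. restrict (\<lambda>v. c (signs G v) v) R) ` F"
      using f(2) by (intro image_eqI[of _ _ c]) (auto simp: restrict_def)
  qed
  ultimately show ?thesis using finite_surj by blast
qed

lemma polyhedron_affine_le:
  assumes "affine_fn g" "affine_fn h" shows "polyhedron {v. g v \<le> h v}"
proof -
  obtain a b c d where *: "\<And>v. g v = a \<bullet> v + b" "\<And>v. h v = c \<bullet> v + d"
    using assms unfolding affine_fn_def by blast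
  have "{v. g v \<le> h v} = {v. (a - c) \<bullet> v \<le> d - b}" by (auto simp: * inner_diff_left)
  then show ?thesis by (simp add: polyhedron_halfspace_le)
qed

text \<open>The cells \<open>Q s\<close> use weak inequalities in order to be polyhedra, so a point
  of \<open>Q (signs G w)\<close> may have ties that \<open>w\<close> lacks. On the half-open
  segment starting at \<open>w\<close> the signs are exactly those of \<open>w\<close>, which gives
  \<open>f = g\<close> there, and continuity carries the equality to the far end.\<close>

lemma selection_imp_piecewise_linear:
  assumes R: "convex R" and G: "finite G" "\<And>g. g \<in> G \<Longrightarrow> affine_fn g" and f: "selection R G f"
  shows "continuous_piecewise_linear_on R f"
proof -
  define Q where "Q s = {v. \<forall>g\<in>G. \<forall>h\<in>G. if (g, h) \<in> s then g v \<le> h v else h v \<le> g v}" for s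
  have poly: "polyhedron (Q s)" for s
  proof -
    let ?H = "\<lambda>p. if p \<in> s then {v. fst p v \<le> snd p v} else {v. snd p v \<le> fst p v}"
    have "v \<in> Q s \<longleftrightarrow> (\<forall>p\<in>G \<times> G. v \<in> ?H p)" for v unfolding Q_def by auto
    then have "Q s = \<Inter>(?H ` (G \<times> G))" by blast
    moreover have "polyhedron (?H p)" if "p \<in> G \<times> G" for p
      using that G(2) by (auto intro: polyhedron_affine_le)
    then have "polyhedron (\<Inter>(?H ` (G \<times> G)))"
      by (intro polyhedron_Inter finite_imageI finite_cartesian_product G(1)) blast
    ultimately show ?thesis by (simp only:)
  qed
  have Qle: "g v \<le> h v" if "v \<in> Q s" "g \<in> G" "h \<in> G" "(g, h) \<in> s" for g h v s
    using that unfolding Q_def by auto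
  have Qge: "h v \<le> g v" if "v \<in> Q s" "g \<in> G" "h \<in> G" "(g, h) \<notin> s" for g h v s
    using that unfolding Q_def by auto
  have "\<exists>a b. \<forall>v\<in>Q (signs G w) \<inter> R. f v = a \<bullet> v + b" if w: "w \<in> R" for w
  proof -
    obtain g where g: "g \<in> G" "f w = g w" using f w unfolding selection_def by blast
    have "f v = g v" if v: "v \<in> Q (signs G w)" "v \<in> R" for v
    proof -
      define z where "z t = (1 - t) *\<^sub>R w + t *\<^sub>R v" for t :: real
      have zR: "z t \<in> R" if "0 \<le> t" "t \<le> 1" for t
        using that R w v unfolding z_def by (simp add: convex_alt)
      have fz: "f (z t) = g (z t)" if t: "0 \<le> t" "t < 1" for t
      proof (rule selection_same_signs[OF R G f w zR _ g])
        fix a b assume ab: "a \<in> G" "b \<in> G"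
        have z: "a (z t) = (1 - t) * a w + t * a v" "b (z t) = (1 - t) * b w + t * b v"
          using ab G unfolding z_def by (auto simp: affine_fn_segment)
        show "a w < b w \<longleftrightarrow> a (z t) < b (z t)"
        proof (cases "a w < b w")
          case True
          then have "a v \<le> b v" using Qle[OF v(1) ab] ab by (auto simp: signs_def)
          then have "(1 - t) * a w + t * a v < (1 - t) * b w + t * b v"
            using True t by (intro add_less_le_mono mult_left_mono) auto
          then show ?thesis using True z by auto
        next
          case False
          then have "b v \<le> a v" using Qge[OF v(1) ab] ab by (auto simp: signs_def)
          then have "(1 - t) * b w + t * b v \<le> (1 - t) * a w + t * a v"
            using False t by (intro add_mono mult_left_mono) auto
          then show ?thesis using False z by auto
        qed
      qed (use t in auto)
      have "continuous_on {0..1} (\<lambda>t. f (z t) - g (z t))"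
      proof (intro continuous_on_diff)
        have cz: "continuous_on {0..1} z" unfolding z_def by (intro continuous_intros)
        show "continuous_on {0..1} (\<lambda>t. f (z t))"
          using f zR unfolding selection_def by (intro continuous_on_compose2[OF _ cz]) auto
        show "continuous_on {0..1} (\<lambda>t. g (z t))"
          by (rule continuous_on_compose2[OF affine_fn_continuous[OF G(2)[OF g(1)]] cz]) auto
      qed
      then have "continuous_on (closure {0..<1}) (\<lambda>t. f (z t) - g (z t))" by simp
      then have "f (z 1) - g (z 1) = 0"
        by (rule continuous_constant_on_closure[where x = 1]) (auto simp: fz)
      then show ?thesis by (simp add: z_def)
    qed
    then show ?thesis using G(2)[OF g(1)] unfolding affine_fn_def by (metis IntD1 IntD2)
  qed
  moreover have "w \<in> Q (signs G w)" for w unfolding Q_def signs_def by auto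
  ultimately show ?thesis
    unfolding continuous_piecewise_linear_on_def using f poly finite_imageI[OF finite_signs[OF G(1)]]
    by (intro conjI exI[of _ "Q ` signs G ` R"]) (auto simp: selection_def)
qed

lemma piecewise_linear_imp_selection:
  assumes "continuous_piecewise_linear_on R f"
  obtains G where "finite G" "\<And>g. g \<in> G \<Longrightarrow> affine_fn g" "selection R G f"
proof -
  obtain \<P> where P: "continuous_on R f" "finite \<P>" "R \<subseteq> \<Union>\<P>"
     "\<And>P. P \<in> \<P> \<Longrightarrow> \<exists>a b. \<forall>v \<in> P \<inter> R. f v = a \<bullet> v + b"
    using assms unfolding continuous_piecewise_linear_on_def by blast
  obtain a b where ab: "\<And>P. P \<in> \<P> \<Longrightarrow> \<forall>v \<in> P \<inter> R. f v = a P \<bullet> v + b P"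
    using P(4) by metis
  show ?thesis
  proof (rule that[of "(\<lambda>P v. a P \<bullet> v + b P) ` \<P>"])
    show "selection R ((\<lambda>P v. a P \<bullet> v + b P) ` \<P>) f"
      unfolding selection_def using P(1,3) ab by fastforce
  qed (use P in \<open>auto simp: affine_fn_def\<close>)
qed

section \<open>Lipschitz bounds for selections\<close>

lemma affine_fn_lipschitz:
  assumes "affine_fn g" shows "\<exists>L\<ge>0. \<forall>v w. g v \<le> g w + L * dist v w"
proof -
  obtain a b where ab: "\<And>v. g v = a \<bullet> v + b" using assms unfolding affine_fn_def by blast
  have "g v \<le> g w + norm a * dist v w" for v w
    using norm_cauchy_schwarz[of a "v - w"] by (simp add: ab dist_norm inner_diff_right)
  then show ?thesis using norm_ge_zero by blast
qed

text \<open>The member used changes from point to point. On a segment, the parameter sets where a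
  given member is used are closed, finite in number and cover everything, so the bounds on them
  glue. \<open>L\<close> sums the constants only to dominate each of them.\<close>

lemma selection_lipschitz:
  assumes R: "convex R" and G: "finite G" "\<And>g. g \<in> G \<Longrightarrow> affine_fn g" and f: "selection R G f"
  obtains L where "L \<ge> 0" "\<And>v w. v \<in> R \<Longrightarrow> w \<in> R \<Longrightarrow> f v \<le> f w + L * dist v w"
proof -
  obtain l where l: "\<And>g. g \<in> G \<Longrightarrow> l g \<ge> 0 \<and> (\<forall>v w. g v \<le> g w + l g * dist v w)"
    using affine_fn_lipschitz[OF G(2)] by metis
  define L where "L = (\<Sum>g\<in>G. l g)"
  have L: "L \<ge> 0" unfolding L_def using l by (auto intro: sum_nonneg)
  have lL: "g v \<le> g w + L * dist v w" if "g \<in> G" for g v w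
  proof -
    have "l g \<le> L" unfolding L_def using l G(1) that by (intro member_le_sum) auto
    then have "l g * dist v w \<le> L * dist v w" by (intro mult_right_mono) auto
    then show ?thesis using l[OF that] by (meson add_left_mono order_trans)
  qed
  show ?thesis
  proof (rule that[OF L])
    fix v w assume v: "v \<in> R" and w: "w \<in> R"
    define z where "z t = (1 - t) *\<^sub>R w + t *\<^sub>R v" for t :: real
    have zR: "z t \<in> R" if "0 \<le> t" "t \<le> 1" for t
      using that R w v unfolding z_def by (simp add: convex_alt)
    have dz: "dist (z s) (z t) = \<bar>s - t\<bar> * dist v w" for s t
    proof -
      have "z s - z t = (s - t) *\<^sub>R (v - w)" unfolding z_def by (simp add: algebra_simps)
      then show ?thesis by (simp add: dist_norm)
    qed
    have cz: "continuous_on {0..1} z" unfolding z_def by (intro continuous_intros)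
    have cfz: "continuous_on {0..1} (\<lambda>t. f (z t))"
      using f zR unfolding selection_def by (intro continuous_on_compose2[OF _ cz]) auto
    have cl: "closed ({0..1} \<inter> (\<lambda>t. f (z t) - g (z t)) -` {0})" if "g \<in> G" for g
      by (intro continuous_closed_preimage continuous_on_diff cfz
            continuous_on_compose2[OF affine_fn_continuous[OF G(2)[OF that]] cz]) auto
    have "(L * dist v w)-lipschitz_on {0..1} (\<lambda>t. f (z t))"
    proof (rule lipschitz_on_closed_Union[where I = G])
      fix g assume g: "g \<in> G"
      show "(L * dist v w)-lipschitz_on ({0..1} \<inter> (\<lambda>t. f (z t) - g (z t)) -` {0}) (\<lambda>t. f (z t))"
      proof (rule lipschitz_onI)
        fix s t assume "s \<in> {0..1} \<inter> (\<lambda>t. f (z t) - g (z t)) -` {0}"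
          "t \<in> {0..1} \<inter> (\<lambda>t. f (z t) - g (z t)) -` {0}"
        then have "f (z s) = g (z s)" "f (z t) = g (z t)" by auto
        then show "dist (f (z s)) (f (z t)) \<le> L * dist v w * dist s t"
          using lL[OF g, of "z s" "z t"] lL[OF g, of "z t" "z s"] dz[of s t] dz[of t s]
          by (auto simp: dist_real_def abs_le_iff abs_minus_commute algebra_simps)
      qed (use L in auto)
    next
      show "{0..1} \<subseteq> (\<Union>g\<in>G. {0..1} \<inter> (\<lambda>t. f (z t) - g (z t)) -` {0})"
      proof
        fix t :: real assume t: "t \<in> {0..1}"
        then obtain g where "g \<in> G" "f (z t) = g (z t)"
          using f zR unfolding selection_def by (metis atLeastAtMost_iff)
        then show "t \<in> (\<Union>g\<in>G. {0..1} \<inter> (\<lambda>t. f (z t) - g (z t)) -` {0})" using t by auto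
      qed
    qed (use G L cl in auto)
    then have "dist (f (z 1)) (f (z 0)) \<le> L * dist v w * dist (1::real) 0"
      by (rule lipschitz_onD) auto
    then show "f v \<le> f w + L * dist v w" by (simp add: z_def dist_real_def)
  qed
qed

section \<open>Extrema of continuous selections on intervals\<close>

text \<open>A minimizing sequence accumulates at some \<open>l\<close>, and \<open>m = u l\<close>
  for a member \<open>u\<close>. If \<open>l\<close> is interior and no other member passes through
  \<open>(l, m)\<close>, then \<open>f\<close> is \<open>u\<close> near \<open>l\<close>, so
  \<open>u\<close> has a local minimum there, is constant, and \<open>m = u p\<close>. The remaining
  cases are the end points and the crossings.\<close>

lemma selection_infimum:
  fixes D :: "real set" and f :: "real \<Rightarrow> real"
  assumes U: "finite U" "\<And>u. u \<in> U \<Longrightarrow> affine_fn u" and f: "selection D U f"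
    and D: "D \<subseteq> {p..q}" "{p<..<q} \<subseteq> D" 
    and lb: "\<And>s. s \<in> D \<Longrightarrow> m \<le> f s" and ap: "\<And>e. e > 0 \<Longrightarrow> \<exists>s\<in>D. f s < m + e"
  shows "(\<exists>u\<in>U. m = u p \<or> m = u q) \<or> (\<exists>u\<in>U. \<exists>v\<in>U. \<exists>s. u \<noteq> v \<and> u s = m \<and> v s = m)"
proof -
  have "\<exists>s\<in>D. f s < m + inverse (real (Suc n))" for n using ap by auto
  then obtain s where s: "\<And>n. s n \<in> D" "\<And>n. f (s n) < m + inverse (real (Suc n))" by metis
  have fs: "(\<lambda>n. f (s n)) \<longlonglongrightarrow> m"
  proof (rule real_tendsto_sandwich)
    show "\<forall>\<^sub>F n in sequentially. m \<le> f (s n)" using lb s by auto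
    show "\<forall>\<^sub>F n in sequentially. f (s n) \<le> m + inverse (real (Suc n))"
      using s(2) less_imp_le by (auto intro!: always_eventually)
    show "(\<lambda>n. m + inverse (real (Suc n))) \<longlonglongrightarrow> m"
      using LIMSEQ_inverse_real_of_nat_add by blast
  qed auto
  have "\<forall>n. s n \<in> {p..q}" using s D by blast
  then obtain r l where r: "l \<in> {p..q}" "strict_mono r" "(s \<circ> r) \<longlonglongrightarrow> l"
    using compact_Icc[of p q] unfolding compact_def by metis
  have fr: "(\<lambda>n. f (s (r n))) \<longlonglongrightarrow> m" using LIMSEQ_subseq_LIMSEQ[OF fs r(2)] by (simp add: o_def)
  have sr: "(\<lambda>n. s (r n)) \<longlonglongrightarrow> l" using r(3) by (simp add: o_def)
  have ul: "\<exists>u\<in>U. m = u l"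
  proof -
    \<comment> \<open>\<open>D\<close> need not contain \<open>l\<close>, so \<open>f l\<close> may
      be meaningless; the closed union of the graphs carries the limit \<open>(l, m)\<close>
      instead.\<close>
    define W where "W = (\<Union>u\<in>U. {z. snd z = u (fst z)})"
    have "closed W" unfolding W_def
    proof (intro closed_UN U ballI)
      fix u assume "u \<in> U"
      then obtain a b where "\<And>s. u s = a \<bullet> s + b" using U(2) unfolding affine_fn_def by blast
      then show "closed {z. snd z = u (fst z)}" by (auto intro!: closed_Collect_eq continuous_intros)
    qed
    moreover have "(s (r n), f (s (r n))) \<in> W" for n
      using f s unfolding selection_def W_def by force
    moreover have "(\<lambda>n. (s (r n), f (s (r n)))) \<longlonglongrightarrow> (l, m)" using sr fr by (rule tendsto_Pair)
    ultimately have "(l, m) \<in> W" by (rule closed_sequentially)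
    then show ?thesis unfolding W_def by auto
  qed
  then obtain u where u: "u \<in> U" "m = u l" by blast
  show ?thesis
  proof (cases "l = p \<or> l = q \<or> (\<exists>v\<in>U. v \<noteq> u \<and> v l = m)")
    case True then show ?thesis using u by auto
  next
    case False
    then have lo: "l \<in> {p<..<q}" using r(1) by auto
    have cf: "continuous_on {p<..<q} f"
      using f D continuous_on_subset unfolding selection_def by blast
    then have cl: "isCont f l" using lo by (simp add: continuous_on_eq_continuous_at)
    have "(\<lambda>n. f (s (r n))) \<longlonglongrightarrow> f l" using isCont_tendsto_compose[OF cl sr] .
    then have fl: "f l = m" using fr LIMSEQ_unique by blast
    have "\<forall>\<^sub>F t in at l. \<forall>v\<in>U - {u}. f t \<noteq> v t"
    proof (subst eventually_ball_finite_distrib; (intro ballI)?)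
      fix v assume v: "v \<in> U - {u}"
      have "isCont (\<lambda>t. f t - v t) l"
        using cl affine_fn_continuous[OF U(2), of v UNIV] v
        by (auto simp: continuous_on_eq_continuous_at)
      moreover have "f l - v l \<noteq> 0" using False v fl by auto
      ultimately have "\<forall>\<^sub>F t in at l. f t - v t \<noteq> 0"
        unfolding isCont_def by (rule tendsto_imp_eventually_ne)
      then show "\<forall>\<^sub>F t in at l. f t \<noteq> v t" by eventually_elim auto
    qed (use U in auto)
    moreover have "\<forall>\<^sub>F t in at l. t \<in> {p<..<q}"
      using lo by (intro eventually_at_in_open') auto
    ultimately have "\<forall>\<^sub>F t in at l. m \<le> u t"
    proof eventually_elim
      case (elim t)
      then have "t \<in> D" using D by auto
      then obtain v where "v \<in> U" "f t = v t" using f unfolding selection_def by blast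
      then have "f t = u t" using elim by auto
      then show ?case using lb[OF \<open>t \<in> D\<close>] by simp
    qed
    then obtain d where d: "d > 0" "\<And>t. t \<noteq> l \<Longrightarrow> dist t l < d \<Longrightarrow> m \<le> u t"
      unfolding eventually_at by auto
    obtain a b where ab: "\<And>t. u t = a * t + b"
      using U(2)[OF u(1)] unfolding affine_fn_def by auto
    have "m \<le> u (l + d/2)" "m \<le> u (l - d/2)" using d by (auto intro!: d simp: dist_real_def)
    then have "a * d \<ge> 0" "a * d \<le> 0" using u(2) by (auto simp: ab algebra_simps)
    then have "a = 0" using d(1) by (simp add: mult_le_0_iff zero_le_mult_iff)
    then have "m = u p" using u by (simp add: ab)
    then show ?thesis using u by blast
  qed
qed

lemma selection_supremum:
  fixes D :: "real set" and f :: "real \<Rightarrow> real"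
  assumes U: "finite U" "\<And>u. u \<in> U \<Longrightarrow> affine_fn u" and f: "selection D U f"
    and D: "D \<subseteq> {p..q}" "{p<..<q} \<subseteq> D" 
    and ub: "\<And>s. s \<in> D \<Longrightarrow> f s \<le> m" and ap: "\<And>e. e > 0 \<Longrightarrow> \<exists>s\<in>D. m - e < f s"
  shows "(\<exists>u\<in>U. m = u p \<or> m = u q) \<or> (\<exists>u\<in>U. \<exists>v\<in>U. \<exists>s. u \<noteq> v \<and> u s = m \<and> v s = m)"
proof -
  let ?N = "\<lambda>(u :: real \<Rightarrow> real) s. - u s"
  have "(\<exists>u\<in>?N ` U. - m = u p \<or> - m = u q) \<or>
      (\<exists>u\<in>?N ` U. \<exists>v\<in>?N ` U. \<exists>s. u \<noteq> v \<and> u s = - m \<and> v s = - m)"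
  proof (rule selection_infimum[where D = D and f = "?N f"])
    show "selection D (?N ` U) (?N f)"
      using f unfolding selection_def by (auto intro!: continuous_intros)
    show "\<exists>s\<in>D. - f s < - m + e" if "e > 0" for e using ap[OF that] by force
  qed (use U D ub in \<open>auto intro!: affine_fn_minus\<close>)
  then show ?thesis by fastforce
qed

section \<open>Regions and delays\<close>

text \<open>Floors and fractional parts are awkward under delays and convex combinations. Strict
  comparisons of clocks and clock differences with integers are affine conditions, and the
  differences are unchanged by a delay.\<close>

lemma region_equiv_iff:
  "region_equiv v w \<longleftrightarrow>
    (\<forall>c (n::int). (v $ c < n \<longleftrightarrow> w $ c < n) \<and> (n < v $ c \<longleftrightarrow> n < w $ c)) \<and>
    (\<forall>c d (n::int). v $ c - v $ d < n \<longleftrightarrow> w $ c - w $ d < n)" (is "?L \<longleftrightarrow> ?R1 \<and> ?R2")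
proof
  assume L: ?L
  have fl: "\<lfloor>v $ c\<rfloor> = \<lfloor>w $ c\<rfloor>" "frac (v $ c) = 0 \<longleftrightarrow> frac (w $ c) = 0"
    "frac (v $ c) \<le> frac (v $ d) \<longleftrightarrow> frac (w $ c) \<le> frac (w $ d)" for c d
    using L unfolding region_equiv_def by blast+
  have "(v $ c < n \<longleftrightarrow> w $ c < n) \<and> (n < v $ c \<longleftrightarrow> n < w $ c)" for c and n :: int
  proof -
    have "x < n \<longleftrightarrow> \<lfloor>x\<rfloor> < n" for x :: real by (simp add: floor_less_iff)
    moreover have "n < x \<longleftrightarrow> n < \<lfloor>x\<rfloor> \<or> n = \<lfloor>x\<rfloor> \<and> frac x \<noteq> 0" for x :: real
      unfolding frac_def by linarith
    ultimately show ?thesis using fl by simp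
  qed
  moreover have "v $ c - v $ d < n \<longleftrightarrow> w $ c - w $ d < n" for c d and n :: int
  proof -
    have "x - y < n \<longleftrightarrow> \<lfloor>x\<rfloor> - \<lfloor>y\<rfloor> < n \<or> \<lfloor>x\<rfloor> - \<lfloor>y\<rfloor> = n \<and> \<not> frac y \<le> frac x" for x y :: real
      unfolding frac_def by linarith
    then show ?thesis using fl by simp
  qed
  ultimately show "?R1 \<and> ?R2" by blast
next
  assume R: "?R1 \<and> ?R2"
  have fl: "\<lfloor>v $ c\<rfloor> = \<lfloor>w $ c\<rfloor>" for c
  proof -
    have "\<not> v $ c < \<lfloor>v $ c\<rfloor>" "v $ c < \<lfloor>v $ c\<rfloor> + 1" by linarith+
    then have "\<not> w $ c < \<lfloor>v $ c\<rfloor>" "w $ c < \<lfloor>v $ c\<rfloor> + 1"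
      using R by (metis, metis of_int_1 of_int_add)
    then show ?thesis by linarith
  qed
  moreover have "frac (v $ c) = 0 \<longleftrightarrow> frac (w $ c) = 0" for c
  proof -
    have "frac x = 0 \<longleftrightarrow> \<not> \<lfloor>x\<rfloor> < x" for x :: real unfolding frac_def by linarith
    then show ?thesis using R fl by metis
  qed
  moreover have "frac (v $ c) \<le> frac (v $ d) \<longleftrightarrow> frac (w $ c) \<le> frac (w $ d)" for c d
  proof -
    have "frac x \<le> frac y \<longleftrightarrow> \<not> y - x < of_int (\<lfloor>y\<rfloor> - \<lfloor>x\<rfloor>)" for x y :: real
      unfolding frac_def by auto
    then show ?thesis using R fl by metis
  qed
  ultimately show ?L unfolding region_equiv_def by blast
qed

lemma clock_region_equiv:
  assumes "clock_region R" "v \<in> R" "w \<in> R" shows "region_equiv v w"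
proof -
  obtain u where "R = {v. region_equiv u v}" using assms(1) unfolding clock_region_def by blast
  then show ?thesis using assms unfolding region_equiv_iff by auto
qed

lemma clock_region_convex:
  assumes "clock_region R" shows "convex R"
  unfolding convex_alt
proof (intro ballI allI impI)
  fix v w and t :: real assume vw: "v \<in> R" "w \<in> R" and t: "0 \<le> t \<and> t \<le> 1"
  define z where "z = (1 - t) *\<^sub>R v + t *\<^sub>R w"
  have vw': "region_equiv v w" using clock_region_equiv assms vw by blast
  have conv: "(1 - t) * a + t * b < n" if "a < n" "b < n" for a b n :: real
    using that t by (intro convex_bound_lt) auto
  have conv': "n \<le> (1 - t) * a + t * b" if "n \<le> a" "n \<le> b" for a b n :: real
    using convex_bound_le[of "-a" "-n" "-b" "1-t" t] that t by auto
  have *: "a < n \<longleftrightarrow> (1 - t) * a + t * b < n" if "a < n \<longleftrightarrow> b < n" for a b n :: real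
    using conv[of a n b] conv'[of n a b] that by linarith
  have **: "n < a \<longleftrightarrow> n < (1 - t) * a + t * b" if "n < a \<longleftrightarrow> n < b" for a b n :: real
    using *[of "-a" "-n" "-b"] that by auto
  have "region_equiv v z"
    unfolding region_equiv_iff
  proof (intro conjI allI)
    fix c and n :: int
    show "v $ c < n \<longleftrightarrow> z $ c < n"
      using *[of "v $ c" n "w $ c"] vw' unfolding region_equiv_iff z_def by auto
    show "n < v $ c \<longleftrightarrow> n < z $ c"
      using **[of n "v $ c" "w $ c"] vw' unfolding region_equiv_iff z_def by auto
  next
    fix c d and n :: int
    have "z $ c - z $ d = (1 - t) * (v $ c - v $ d) + t * (w $ c - w $ d)"
      unfolding z_def by (simp add: algebra_simps)
    then show "v $ c - v $ d < n \<longleftrightarrow> z $ c - z $ d < n"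
      using *[of "v $ c - v $ d" n "w $ c - w $ d"] vw' unfolding region_equiv_iff by auto
  qed
  moreover obtain u where "R = {v. region_equiv u v}" using assms unfolding clock_region_def by blast
  ultimately show "z \<in> R" using vw(1) unfolding region_equiv_iff by auto
qed

lemma satisfies_cong:
  assumes "\<And>c (n::int). (v $ c < n \<longleftrightarrow> w $ c < n) \<and> (n < v $ c \<longleftrightarrow> n < w $ c)"
  shows "satisfies v C \<longleftrightarrow> satisfies w C"
proof -
  have "cmp_holds r (v $ c) (real n) \<longleftrightarrow> cmp_holds r (w $ c) (real n)" for r c n
    using assms[of c "int n"] by (cases r) auto
  then show ?thesis unfolding satisfies_def by auto
qed

lemma of_int_between_iff:
  fixes x y :: real and n N :: int
  assumes "N < x" "x < N + 1" "N < y" "y < N + 1"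
  shows "(x < n \<longleftrightarrow> y < n) \<and> (n < x \<longleftrightarrow> n < y)"
proof (cases "n \<le> N")
  case True
  then have "real_of_int n \<le> N" by simp
  then show ?thesis using assms by linarith
next
  case False
  then have "real_of_int N + 1 \<le> n" by linarith
  then show ?thesis using assms by linarith
qed

text \<open>Time-abstract bisimulation with a quantitative bound. If a clock \<open>c\<close> is an
  integer after delay \<open>d\<close>, the same clock of \<open>w\<close> is sent to the same
  integer, and then \<open>d - e = w $ c - v $ c\<close>. Otherwise an open interval of delays is
  admissible and one within \<open>r\<close> of \<open>d\<close> is picked.\<close>

lemma region_delay:
  fixes v w :: "'c::finite valuation"
  assumes eqv: "region_equiv v w" and d: "0 \<le> d" and r: "\<And>c. \<bar>v $ c - w $ c\<bar> < r"
  obtains e where "0 \<le> e" "\<bar>d - e\<bar> < r" "\<And>C. satisfies (delay v d) C \<longleftrightarrow> satisfies (delay w e) C"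
proof -
  have single: "v $ c < n \<longleftrightarrow> w $ c < n" "n < v $ c \<longleftrightarrow> n < w $ c" for c and n :: int
    using eqv unfolding region_equiv_iff by auto
  have diff: "v $ c - v $ d < n \<longleftrightarrow> w $ c - w $ d < n" for c d and n :: int
    using eqv unfolding region_equiv_iff by auto
  have "\<exists>e\<ge>0. \<bar>d - e\<bar> < r \<and>
     (\<forall>c (n::int). (v $ c + d < n \<longleftrightarrow> w $ c + e < n) \<and> (n < v $ c + d \<longleftrightarrow> n < w $ c + e))"
  proof (cases "\<exists>c (n::int). v $ c + d = n")
    case True
    then obtain c and n :: int where cn: "v $ c + d = n" by blast
    define e where "e = n - w $ c"
    have "\<not> n < w $ c" using single(2)[of n c] cn d by linarith
    then have "0 \<le> e" unfolding e_def by simp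
    moreover have "\<bar>d - e\<bar> < r" using r[of c] cn unfolding e_def by linarith
    moreover have "(v $ b + d < m \<longleftrightarrow> w $ b + e < m) \<and> (m < v $ b + d \<longleftrightarrow> m < w $ b + e)" for b and m :: int
      using diff[of b c "m - n"] diff[of c b "n - m"] cn unfolding e_def by (auto simp: algebra_simps)
    ultimately show ?thesis by blast
  next
    case False
    define N where "N c = \<lfloor>v $ c + d\<rfloor>" for c
    have N: "N c < v $ c + d" "v $ c + d < N c + 1" for c
      using False floor_correct[of "v $ c + d"] unfolding N_def by (auto simp: less_le)
    \<comment> \<open>All demands on \<open>e\<close> are strict bounds: positivity, distance to
      \<open>d\<close>, and each clock of \<open>w\<close> ending in the same open unit interval as
      that of \<open>v\<close>. Region equivalence puts every lower bound below every upper bound;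
      bounds from two different clocks are compared through the clock differences.\<close>
    define Lo where "Lo = insert 0 (insert (d - r) (range (\<lambda>c. N c - w $ c)))"
    define Up where "Up = insert (d + r) (range (\<lambda>c. N c + 1 - w $ c))"
    have rp: "r > 0" using r[of undefined] by linarith
    have N0: "w $ c < N c + 1" for c
      using single(1)[of c "N c + 1"] N(2)[of c] d by auto
    have NN: "w $ c - w $ b < N c + 1 - N b" for b c
      using diff[of c b "N c + 1 - N b"] N(2)[of c] N(1)[of b] by auto
    have "a < b" if "a \<in> Lo" "b \<in> Up" for a b
    proof -
      have "0 < N c + 1 - w $ c" "d - r < N c + 1 - w $ c" "N c - w $ c < d + r"
        "N c - w $ c < N c' + 1 - w $ c'" for c c'
        using N0[of c] N[of c] r[of c] NN[of c' c] by (auto simp: abs_less_iff)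
      then show ?thesis using that rp d unfolding Lo_def Up_def by auto
    qed
    moreover have fin: "finite Lo" "Lo \<noteq> {}" "finite Up" "Up \<noteq> {}" unfolding Lo_def Up_def by auto
    ultimately have "Max Lo < Min Up" using Max_in[of Lo] Min_in[of Up] by blast
    then obtain e where "Max Lo < e" "e < Min Up" using dense[of "Max Lo" "Min Up"] by blast
    then have e: "a \<in> Lo \<Longrightarrow> a < e" "a \<in> Up \<Longrightarrow> e < a" for a
      using fin Max_ge[of Lo a] Min_le[of Up a] by auto
    have "0 \<le> e" "\<bar>d - e\<bar> < r" using e(1)[of 0] e(1)[of "d - r"] e(2)[of "d + r"]
      by (auto simp: Lo_def Up_def)
    moreover have "(v $ c + d < n \<longleftrightarrow> w $ c + e < n) \<and> (n < v $ c + d \<longleftrightarrow> n < w $ c + e)" for c and n :: int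
    proof -
      have "N c - w $ c < e" "e < N c + 1 - w $ c" using e unfolding Lo_def Up_def by auto
      then show ?thesis using of_int_between_iff[OF N[of c], of "w $ c + e"] by (simp add: algebra_simps)
    qed
    ultimately show ?thesis by blast
  qed
  then obtain e where e: "e \<ge> 0" "\<bar>d - e\<bar> < r"
     "\<And>c (n::int). (v $ c + d < n \<longleftrightarrow> w $ c + e < n) \<and> (n < v $ c + d \<longleftrightarrow> n < w $ c + e)" by auto
  show ?thesis
    by (rule that[OF e(1,2)], rule satisfies_cong) (use e(3) in \<open>simp add: delay_def\<close>)
qed

section \<open>Guard intervals and their end points\<close>

definition guard_delays :: "'c::finite valuation \<Rightarrow> 'c clock_constraint set \<Rightarrow> real set" where
  "guard_delays v C = {d. 0 \<le> d \<and> satisfies (delay v d) C}"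

text \<open>Delay 0 counts because a guard interval may be cut off by nonnegativity of delays
  alone.\<close>

definition event :: "'c::finite valuation \<Rightarrow> real \<Rightarrow> bool" where
  "event v d \<longleftrightarrow> d = 0 \<or> (\<exists>c (n::int). v $ c + d = n)"

lemma guard_delays_between:
  assumes "a \<in> guard_delays v C" "b \<in> guard_delays v C" "a \<le> d" "d \<le> b"
  shows "d \<in> guard_delays v C"
proof -
  have "cmp_holds r (x + d) n" if "cmp_holds r (x + a) n" "cmp_holds r (x + b) n" for r x n
    using that assms(3,4) by (cases r) auto
  then show ?thesis using assms(1,2,3) unfolding guard_delays_def satisfies_def delay_def
    by (fastforce simp: case_prod_beta)
qed

text \<open>Near a positive delay that puts no clock on an integer, no comparison of a clock with an
  integer changes, so membership in the guard set is locally constant there.\<close>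

lemma event_if_frontier:
  assumes d: "0 \<le> d" and fr: "d \<in> closure (guard_delays v C)" "\<And>e. e > 0 \<Longrightarrow> \<exists>t. \<bar>t - d\<bar> < e \<and> t \<notin> guard_delays v C"
  shows "event v d"
proof (rule ccontr)
  assume ne: "\<not> event v d"
  then have dpos: "d > 0" using d unfolding event_def by auto
  define N where "N c = \<lfloor>v $ c + d\<rfloor>" for c
  have N: "N c < v $ c + d" "v $ c + d < N c + 1" for c
    using ne floor_correct[of "v $ c + d"] unfolding N_def event_def by (auto simp: less_le)
  define e where "e = Min (insert d (range (\<lambda>c. min (v $ c + d - N c) (N c + 1 - v $ c - d))))"
  have "e > 0" unfolding e_def using N dpos by (subst Min_gr_iff) (auto simp: algebra_simps)
  have ed: "e \<le> d" "e \<le> v $ c + d - N c" "e \<le> N c + 1 - v $ c - d" for c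
  proof -
    have "e \<le> d" unfolding e_def by (rule Min_le) auto
    moreover have "e \<le> min (v $ c + d - N c) (N c + 1 - v $ c - d)"
      unfolding e_def by (rule Min_le) auto
    ultimately show "e \<le> d" "e \<le> v $ c + d - N c" "e \<le> N c + 1 - v $ c - d" by auto
  qed
  have "t \<in> guard_delays v C \<longleftrightarrow> d \<in> guard_delays v C" if "\<bar>t - d\<bar> < e" for t
  proof -
    have "satisfies (delay v t) C \<longleftrightarrow> satisfies (delay v d) C"
    proof (rule satisfies_cong)
      fix c and n :: int
      have "N c < v $ c + t" "v $ c + t < N c + 1" using ed(2)[of c] ed(3)[of c] that by linarith+
      then show "(delay v t $ c < n) = (delay v d $ c < n) \<and> (n < delay v t $ c) = (n < delay v d $ c)"
        using of_int_between_iff[OF N[of c], of "v $ c + t"] by (simp add: delay_def)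
    qed
    then show ?thesis using that ed(1) d unfolding guard_delays_def by auto
  qed
  moreover obtain s where "s \<in> guard_delays v C" "\<bar>s - d\<bar> < e"
    using fr(1) \<open>e > 0\<close> unfolding closure_approachable by (auto simp: dist_real_def)
  ultimately show False using fr(2)[OF \<open>e > 0\<close>] by blast
qed

text \<open>\<open>p\<close> and \<open>q\<close> are the infimum and supremum; strict guards may
  exclude them, hence only membership in the closure.\<close>

lemma guard_delays_interval:
  assumes ne: "guard_delays v C \<noteq> {}" and bd: "bdd_above (guard_delays v C)"
  obtains p q where "0 \<le> p" "guard_delays v C \<subseteq> {p..q}" "{p<..<q} \<subseteq> guard_delays v C"
    "p \<in> closure (guard_delays v C)" "q \<in> closure (guard_delays v C)" "event v p" "event v q"
proof -
  let ?D = "guard_delays v C"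
  have bb: "bdd_below ?D" unfolding guard_delays_def by (auto simp: bdd_below_def)
  have sub: "?D \<subseteq> {Inf ?D..Sup ?D}" using cInf_lower[OF _ bb] cSup_upper[OF _ bd] by auto
  have cl: "Inf ?D \<in> closure ?D" "Sup ?D \<in> closure ?D"
    using closure_contains_Inf[OF ne bb] closure_contains_Sup[OF ne bd] by auto
  have p0: "0 \<le> Inf ?D" using cInf_greatest[OF ne, of 0] unfolding guard_delays_def by auto
  have q0: "0 \<le> Sup ?D" using ne p0 sub by fastforce
  have inside: "{Inf ?D<..<Sup ?D} \<subseteq> ?D"
  proof
    fix d assume d: "d \<in> {Inf ?D<..<Sup ?D}"
    then obtain a b where "a \<in> ?D" "a < d" "b \<in> ?D" "d < b"
      using cInf_lessD[OF ne] less_cSupD[OF ne] by (metis greaterThanLessThan_iff)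
    then show "d \<in> ?D" using guard_delays_between less_imp_le by blast
  qed
  have "event v (Inf ?D)"
    by (rule event_if_frontier[OF p0 cl(1)], rule_tac x = "Inf ?D - e/2" in exI) (use sub in force)
  moreover have "event v (Sup ?D)"
    by (rule event_if_frontier[OF q0 cl(2)], rule_tac x = "Sup ?D + e/2" in exI) (use sub in force)
  ultimately show ?thesis using that[OF p0 sub inside cl] by blast
qed

text \<open>The record \<open>kernel\<close> shadows the function \<open>extend\<close> on runs by a record operation.\<close>

hide_const (open) kernel.extend
hide_fact (open) kernel.extend_def

section \<open>Plays of kernel games and value iteration\<close>

lemma fst_play_prefix [simp]: "fst (play_prefix K \<sigma> \<tau> c n) = c"
  by (induction n) (auto simp: Let_def extend_def)

lemma last_config_extend [simp]: "last_config (extend \<rho> m) = successor (last_config \<rho>) m"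
  by (simp add: extend_def last_config_def)

lemma moves_goal: "fst c \<in> goals K \<Longrightarrow> moves K c = {}"
  by (auto simp: moves_def split: prod.splits)

lemma moves_iff:
  "(d, t) \<in> moves K (l, v) \<longleftrightarrow>
     l \<notin> goals K \<and> t \<in> transitions K \<and> source t = l \<and> d \<in> guard_delays v (guard t)"
  by (auto simp: moves_def guard_delays_def)

lemma play_prefix_stop:
  "n \<le> m \<Longrightarrow> moves K (last_config (play_prefix K \<sigma> \<tau> c n)) = {} \<Longrightarrow>
   play_prefix K \<sigma> \<tau> c m = play_prefix K \<sigma> \<tau> c n"
  by (induction rule: dec_induct) (auto simp: Let_def)

lemma opt_goal [simp]: "l \<in> goals K \<Longrightarrow> opt K k l v = ereal (w_out K l v)"
  by (cases k) auto

lemma opt_antimono_Suc: "opt K (Suc k) l v \<le> opt K k l v"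
proof (induction k arbitrary: l v)
  case 0
  show ?case by simp
next
  case (Suc k)
  show ?case
  proof (cases "l \<in> goals K")
    case False
    have "(INF m\<in>moves K (l, v). opt K (Suc k) (target (snd m)) (after m v))
        \<le> (INF m\<in>moves K (l, v). opt K k (target (snd m)) (after m v))"
      by (rule INF_mono) (use Suc in blast)
    moreover have "(SUP m\<in>moves K (l, v). opt K (Suc k) (target (snd m)) (after m v))
        \<le> (SUP m\<in>moves K (l, v). opt K k (target (snd m)) (after m v))"
      by (rule SUP_mono) (use Suc in blast)
    ultimately show ?thesis using False by (simp only: opt.simps if_False split: if_split) auto
  qed simp
qed

lemma opt_antimono: "j \<le> k \<Longrightarrow> opt K k l v \<le> opt K j l v"
  by (induction rule: dec_induct) (auto intro: order_trans[OF opt_antimono_Suc] simp del: opt.simps)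

context
  fixes K :: "('l, 'c::finite) kernel"
  assumes kernel: "kernel_wtg K"
begin

lemma is_wtg: "is_wtg K"
  using kernel unfolding kernel_wtg_def by blast

lemma last_config_locs: "\<rho> \<in> runs K \<Longrightarrow> fst (last_config \<rho>) \<in> locs K"
proof (induction rule: runs.induct)
  case (step \<rho> m)
  then have "snd m \<in> transitions K" by (auto simp: moves_def split: prod.splits)
  then show ?case using is_wtg unfolding is_wtg_def by (simp add: successor_def)
qed (simp add: last_config_def)

lemma accumulated_weight_zero: "\<rho> \<in> runs K \<Longrightarrow> accumulated_weight K \<rho> = 0"
proof (induction rule: runs.induct)
  case (step \<rho> m)
  obtain d t where m: "m = (d, t)" by fastforce
  have "t \<in> transitions K" using step m by (auto simp: moves_def split: prod.splits)
  moreover from this have "source t \<in> locs K" using is_wtg unfolding is_wtg_def by blast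
  ultimately have "loc_weight K (source t) = 0" "trans_weight K t = 0"
    using kernel unfolding kernel_wtg_def by auto
  then show ?case using step m by (simp add: accumulated_weight_def extend_def)
qed (simp add: accumulated_weight_def)

lemma run_reg:
  assumes "\<rho> \<in> runs K" "snd (fst \<rho>) \<in> reg K (fst (fst \<rho>))"
  shows "snd (last_config \<rho>) \<in> reg K (fst (last_config \<rho>))" 
    "0 \<le> snd (last_config \<rho>) $ c \<and> snd (last_config \<rho>) $ c \<le> 1"
proof -
  have "last_config \<rho> \<in> reachable K" using assms unfolding reachable_def by blast
  then show "snd (last_config \<rho>) \<in> reg K (fst (last_config \<rho>))" 
    "0 \<le> snd (last_config \<rho>) $ c \<and> snd (last_config \<rho>) $ c \<le> 1"
    using kernel unfolding kernel_wtg_def by (auto simp: case_prod_beta)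
qed

lemma reg_unit: "l \<in> locs K \<Longrightarrow> v \<in> reg K l \<Longrightarrow> 0 \<le> v $ c \<and> v $ c \<le> 1"
  using run_reg(2)[of "((l, v), [])" c] runs.start[of l K v] by (simp add: last_config_def)

text \<open>Every configuration in the region of its location counts as initial, so already the
  one-step run from it is subject to the kernel condition.\<close>

lemma moves_reg:
  assumes "l \<in> locs K" "v \<in> reg K l" "m \<in> moves K (l, v)"
  shows "target (snd m) \<in> locs K" "after m v \<in> reg K (target (snd m))"
proof -
  let ?\<rho> = "((l, v), [])"
  have "extend ?\<rho> m \<in> runs K"
    using assms by (intro runs.step runs.start) (auto simp: last_config_def)
  then show "target (snd m) \<in> locs K" "after m v \<in> reg K (target (snd m))"
    using last_config_locs[of "extend ?\<rho> m"] run_reg(1)[of "extend ?\<rho> m"] assms(2)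
    by (auto simp: extend_def last_config_def successor_def)
qed

lemma reg_region: "l \<in> locs K \<Longrightarrow> clock_region (reg K l)"
  using kernel unfolding kernel_wtg_def by blast

section \<open>Plays under a fixed pair of strategies\<close>

context
  fixes \<sigma> \<tau> :: "('l, 'c) strategy" and c :: "('l, 'c) config"
  assumes \<sigma>: "\<sigma> \<in> min_strategies K" and \<tau>: "\<tau> \<in> max_strategies K"
    and c: "fst c \<in> locs K" "snd c \<in> reg K (fst c)"
begin

lemma play_prefix_step:
  assumes "\<rho> = play_prefix K \<sigma> \<tau> c n" "\<rho> \<in> runs K" "moves K (last_config \<rho>) \<noteq> {}"
  obtains m where "m \<in> moves K (last_config \<rho>)" "play_prefix K \<sigma> \<tau> c (Suc n) = extend \<rho> m"
    "fst (last_config \<rho>) \<in> min_locs K \<Longrightarrow> m = \<sigma> \<rho>"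
    "fst (last_config \<rho>) \<notin> min_locs K \<Longrightarrow> m = \<tau> \<rho>"
proof -
  have "fst (last_config \<rho>) \<in> locs K" using assms last_config_locs by blast
  then have "(if fst (last_config \<rho>) \<in> min_locs K then \<sigma> \<rho> else \<tau> \<rho>) \<in> moves K (last_config \<rho>)"
    using \<sigma> \<tau> assms unfolding min_strategies_def max_strategies_def strategies_def locs_def by auto
  then show ?thesis using that assms by (auto simp: Let_def)
qed

lemma play_prefix_runs: "play_prefix K \<sigma> \<tau> c n \<in> runs K"
proof (induction n)
  case 0
  show ?case using runs.start[of "fst c" K "snd c"] c by simp
next
  case (Suc n)
  show ?case
  proof (cases "moves K (last_config (play_prefix K \<sigma> \<tau> c n)) = {}")
    case True
    then show ?thesis using Suc by (simp add: Let_def)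
  next
    case False
    then show ?thesis using play_prefix_step[OF refl Suc] runs.step[OF Suc] by metis
  qed
qed

lemma play_prefix_reg:
  fixes n defines "c' \<equiv> last_config (play_prefix K \<sigma> \<tau> c n)"
  shows "fst c' \<in> locs K" "snd c' \<in> reg K (fst c')"
  using last_config_locs[OF play_prefix_runs] run_reg(1)[OF play_prefix_runs] c
  unfolding c'_def by auto

lemma play_weight_goal:
  assumes "last_config (play_prefix K \<sigma> \<tau> c n) = (l, v)" "l \<in> goals K"
  shows "play_weight K \<sigma> \<tau> c = ereal (w_out K l v)"
proof -
  define P where "P n \<longleftrightarrow> fst (last_config (play_prefix K \<sigma> \<tau> c n)) \<in> goals K" for n
  have "P n" using assms unfolding P_def by simp
  then have "P (LEAST n. P n)" "(LEAST n. P n) \<le> n" by (auto intro: LeastI Least_le)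
  then have "play_prefix K \<sigma> \<tau> c n = play_prefix K \<sigma> \<tau> c (LEAST n. P n)"
    unfolding P_def by (intro play_prefix_stop moves_goal)
  then have "last_config (play_prefix K \<sigma> \<tau> c (LEAST n. P n)) = (l, v)" using assms by simp
  moreover have "\<exists>n. P n" using \<open>P n\<close> by blast
  ultimately show ?thesis
    using accumulated_weight_zero[OF play_prefix_runs, of "LEAST n. P n"]
    unfolding play_weight_def P_def by (simp add: Let_def)
qed

lemma play_weight_no_goal:
  "(\<And>n. fst (last_config (play_prefix K \<sigma> \<tau> c n)) \<notin> goals K) \<Longrightarrow> play_weight K \<sigma> \<tau> c = \<infinity>"
  unfolding play_weight_def by auto

end

text \<open>Picks a move into \<open>P\<close> when there is one and any legal move otherwise.
  \<open>P\<close> also sees the number of moves made so far: Min needs it because the index of the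
  iterate decreases along the play, Max ignores it.\<close>

definition threshold_strategy :: "(nat \<Rightarrow> ('l, 'c) config \<Rightarrow> bool) \<Rightarrow> ('l, 'c) strategy" where
  "threshold_strategy P \<rho> = (SOME m. m \<in> moves K (last_config \<rho>) \<and>
      ((\<exists>m' \<in> moves K (last_config \<rho>). P (length (snd \<rho>)) (successor (last_config \<rho>) m')) \<longrightarrow>
        P (length (snd \<rho>)) (successor (last_config \<rho>) m)))"

lemma threshold_strategy:
  assumes "moves K (last_config \<rho>) \<noteq> {}"
  shows "threshold_strategy P \<rho> \<in> moves K (last_config \<rho>)"
    "m \<in> moves K (last_config \<rho>) \<Longrightarrow> P (length (snd \<rho>)) (successor (last_config \<rho>) m) \<Longrightarrow>
       P (length (snd \<rho>)) (successor (last_config \<rho>) (threshold_strategy P \<rho>))"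
proof -
  let ?Q = "\<lambda>m. m \<in> moves K (last_config \<rho>) \<and>
      ((\<exists>m' \<in> moves K (last_config \<rho>). P (length (snd \<rho>)) (successor (last_config \<rho>) m')) \<longrightarrow>
        P (length (snd \<rho>)) (successor (last_config \<rho>) m))"
  have "\<exists>m. ?Q m" using assms by blast
  then have "?Q (threshold_strategy P \<rho>)" unfolding threshold_strategy_def by (rule someI_ex)
  then show "threshold_strategy P \<rho> \<in> moves K (last_config \<rho>)"
    "m \<in> moves K (last_config \<rho>) \<Longrightarrow> P (length (snd \<rho>)) (successor (last_config \<rho>) m) \<Longrightarrow>
       P (length (snd \<rho>)) (successor (last_config \<rho>) (threshold_strategy P \<rho>))" by blast+
qed

lemma threshold_strategy_in: "threshold_strategy P \<in> strategies K A"
  unfolding strategies_def using threshold_strategy(1) by blast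

lemma max_strategies_nonempty: "max_strategies K \<noteq> {}"
  unfolding max_strategies_def using threshold_strategy_in by blast

text \<open>A play blocked outside the goals weighs \<infinity> under all strategies. Existence of a
  Max strategy keeps the inner supremum from being empty.\<close>

lemma moves_nonempty:
  assumes "l \<in> locs K" "v \<in> reg K l" "l \<notin> goals K" "\<bar>Val K l v\<bar> \<noteq> \<infinity>"
  shows "moves K (l, v) \<noteq> {}"
proof
  assume e: "moves K (l, v) = {}"
  have p: "play_prefix K \<sigma> \<tau> (l, v) n = ((l, v), [])" for \<sigma> \<tau> n
    using play_prefix_stop[of 0 n K \<sigma> \<tau> "(l, v)"] e by (simp add: last_config_def)
  have "play_weight K \<sigma> \<tau> (l, v) = \<infinity>" for \<sigma> \<tau>
    using assms(3) unfolding play_weight_def p by (simp add: last_config_def)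
  then have "Val K l v = \<infinity>" unfolding Val_def using max_strategies_nonempty
    by (simp add: top_ereal_def[symmetric])
  then show False using assms(4) by simp
qed

definition opt_conf :: "nat \<Rightarrow> ('l, 'c) config \<Rightarrow> ereal" where
  "opt_conf k c = opt K k (fst c) (snd c)"

lemma opt_conf_Suc:
  "fst c \<notin> goals K \<Longrightarrow> opt_conf (Suc k) c =
    (if fst c \<in> min_locs K then INF m \<in> moves K c. opt_conf k (successor c m)
     else SUP m \<in> moves K c. opt_conf k (successor c m))"
  by (simp add: opt_conf_def successor_def)

text \<open>After \<open>n\<close> steps Min keeps the iterate with the remaining index
  \<open>k - n\<close> below \<open>M\<close>. At index 0 this is possible only in a goal, with
  output below \<open>M\<close>. Without \<open>live\<close>, a blocked Max location would have
  iterate -\<infinity> and break the bound.\<close>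

lemma Val_le_opt:
  assumes live: "\<And>l v. l \<in> locs K \<Longrightarrow> v \<in> reg K l \<Longrightarrow> l \<notin> goals K \<Longrightarrow> moves K (l, v) \<noteq> {}"
    and c: "l \<in> locs K" "v \<in> reg K l"
  shows "Val K l v \<le> opt K k l v"
proof (rule dense_ge)
  fix M assume M: "opt K k l v < M"
  define \<sigma> where "\<sigma> = threshold_strategy (\<lambda>n c. opt_conf (k - Suc n) c < M)"
  have \<sigma>: "\<sigma> \<in> min_strategies K" unfolding \<sigma>_def min_strategies_def by (rule threshold_strategy_in)
  have "play_weight K \<sigma> \<tau> (l, v) \<le> M" if \<tau>: "\<tau> \<in> max_strategies K" for \<tau>
  proof -
    define \<rho> where "\<rho> n = play_prefix K \<sigma> \<tau> (l, v) n" for n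
    note run = play_prefix_runs[OF \<sigma> \<tau>, of "(l, v)", simplified, OF c, folded \<rho>_def]
    note reg = play_prefix_reg[OF \<sigma> \<tau>, of "(l, v)", simplified, OF c, folded \<rho>_def]
    \<comment> \<open>The prefix stops growing at a goal, where all iterates agree and the index is
      irrelevant. Elsewhere the length must equal \<open>n\<close>, so that the strategy aims at the
      right index.\<close>
    have inv: "(fst (last_config (\<rho> n)) \<in> goals K \<or> length (snd (\<rho> n)) = n) \<and>
        opt_conf (k - n) (last_config (\<rho> n)) < M" if "n \<le> k" for n
      using that
    proof (induction n)
      case 0
      then show ?case using M by (simp add: \<rho>_def last_config_def opt_conf_def)
    next
      case (Suc n)
      let ?c = "last_config (\<rho> n)"
      have IH: "fst ?c \<in> goals K \<or> length (snd (\<rho> n)) = n" "opt_conf (k - n) ?c < M"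
        using Suc by auto
      have k: "k - n = Suc (k - Suc n)" using Suc by simp
      show ?case
      proof (cases "fst ?c \<in> goals K")
        case True
        then have "\<rho> (Suc n) = \<rho> n" using moves_goal[OF True] unfolding \<rho>_def by (simp add: Let_def)
        then show ?thesis using IH True by (simp add: opt_conf_def)
      next
        case False
        then have len: "length (snd (\<rho> n)) = n" using IH by simp
        have ne: "moves K ?c \<noteq> {}" using live[OF reg False] by simp
        obtain m where m: "m \<in> moves K ?c" "\<rho> (Suc n) = extend (\<rho> n) m"
            "fst ?c \<in> min_locs K \<Longrightarrow> m = \<sigma> (\<rho> n)"
          unfolding \<rho>_def[of "Suc n"]
          by (rule play_prefix_step[OF \<sigma> \<tau> _ _ \<rho>_def run ne]) (use c in auto)
        have "opt_conf (k - Suc n) (successor ?c m) < M"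
        proof (cases "fst ?c \<in> min_locs K")
          case True
          then obtain m' where "m' \<in> moves K ?c" "opt_conf (k - Suc n) (successor ?c m') < M"
            using IH(2) False unfolding k by (auto simp: opt_conf_Suc INF_less_iff)
          then show ?thesis using threshold_strategy(2)[OF ne, of m' "\<lambda>n c. opt_conf (k - Suc n) c < M"]
            unfolding m(3)[OF True] \<sigma>_def len by blast
        next
          case False
          then have "opt_conf (k - n) ?c = (SUP m \<in> moves K ?c. opt_conf (k - Suc n) (successor ?c m))"
            using \<open>fst ?c \<notin> goals K\<close> unfolding k by (simp add: opt_conf_Suc)
          then have "opt_conf (k - Suc n) (successor ?c m) \<le> opt_conf (k - n) ?c"
            using SUP_upper[OF m(1)] by simp
          then show ?thesis using IH(2) by (rule order_le_less_trans)
        qed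
        then show ?thesis using m(2) len by (simp add: extend_def) (simp add: extend_def[symmetric])
      qed
    qed
    obtain l' v' where lv: "last_config (\<rho> k) = (l', v')" by fastforce
    have "opt K 0 l' v' < M" using inv[of k] lv by (simp add: opt_conf_def)
    then have "l' \<in> goals K" "w_out K l' v' < M" by (auto split: if_splits)
    then show ?thesis using play_weight_goal[OF \<sigma> \<tau>, of "(l, v)" k l' v'] lv c unfolding \<rho>_def by auto
  qed
  then have "(SUP \<tau> \<in> max_strategies K. play_weight K \<sigma> \<tau> (l, v)) \<le> M" by (rule SUP_least)
  then show "Val K l v \<le> M" unfolding Val_def using \<sigma> by (rule INF_lower2[rotated])
qed

text \<open>Stability lets Max keep the same iterate above \<open>M\<close> forever. If the play
  meets a goal, its output exceeds \<open>M\<close>; otherwise its weight is \<infinity>.\<close>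

lemma opt_le_Val:
  assumes stable: "value_iteration_stable K k"
    and c: "l \<in> locs K" "v \<in> reg K l"
  shows "opt K k l v \<le> Val K l v"
proof (rule dense_le)
  fix M assume M: "M < opt K k l v"
  define \<tau> where "\<tau> = threshold_strategy (\<lambda>_ c. M < opt_conf k c)"
  have \<tau>: "\<tau> \<in> max_strategies K" unfolding \<tau>_def max_strategies_def by (rule threshold_strategy_in)
  have "M \<le> play_weight K \<sigma> \<tau> (l, v)" if \<sigma>: "\<sigma> \<in> min_strategies K" for \<sigma>
  proof -
    define \<rho> where "\<rho> n = play_prefix K \<sigma> \<tau> (l, v) n" for n
    note run = play_prefix_runs[OF \<sigma> \<tau>, of "(l, v)", simplified, OF c, folded \<rho>_def]
    note reg = play_prefix_reg[OF \<sigma> \<tau>, of "(l, v)", simplified, OF c, folded \<rho>_def]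
    have inv: "M < opt_conf k (last_config (\<rho> n))" for n
    proof (induction n)
      case 0
      then show ?case using M by (simp add: \<rho>_def last_config_def opt_conf_def)
    next
      case (Suc n)
      let ?c = "last_config (\<rho> n)"
      show ?case
      proof (cases "moves K ?c = {}")
        case True
        then have "\<rho> (Suc n) = \<rho> n" unfolding \<rho>_def by (simp add: Let_def)
        then show ?thesis using Suc by simp
      next
        case ne: False
        then have ng: "fst ?c \<notin> goals K" using moves_goal by blast
        have eq: "opt_conf k ?c = opt_conf (Suc k) ?c"
          using stable reg unfolding value_iteration_stable_def opt_conf_def by metis
        obtain m where m: "m \<in> moves K ?c" "\<rho> (Suc n) = extend (\<rho> n) m"
            "fst ?c \<notin> min_locs K \<Longrightarrow> m = \<tau> (\<rho> n)"
          unfolding \<rho>_def[of "Suc n"]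
          by (rule play_prefix_step[OF \<sigma> \<tau> _ _ \<rho>_def run ne]) (use c in auto)
        have "M < opt_conf k (successor ?c m)"
        proof (cases "fst ?c \<in> min_locs K")
          case True
          then have "opt_conf (Suc k) ?c = (INF m \<in> moves K ?c. opt_conf k (successor ?c m))"
            using ng by (simp add: opt_conf_Suc)
          then have "opt_conf k ?c \<le> opt_conf k (successor ?c m)"
            unfolding eq using INF_lower[OF m(1)] by simp
          with Suc show ?thesis by (rule order_less_le_trans)
        next
          case False
          then obtain m' where "m' \<in> moves K ?c" "M < opt_conf k (successor ?c m')"
            using Suc ng unfolding eq by (auto simp: opt_conf_Suc less_SUP_iff)
          then show ?thesis using threshold_strategy(2)[OF ne, of m' "\<lambda>_ c. M < opt_conf k c"]
            unfolding m(3)[OF False] \<tau>_def by blast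
        qed
        then show ?thesis using m(2) by simp
      qed
    qed
    show ?thesis
    proof (cases "\<exists>n. fst (last_config (\<rho> n)) \<in> goals K")
      case True
      then obtain n l' v' where lv: "last_config (\<rho> n) = (l', v')" "l' \<in> goals K"
        by (metis prod.collapse)
      then have "M < w_out K l' v'" using inv[of n] by (simp add: opt_conf_def)
      then show ?thesis using play_weight_goal[OF \<sigma> \<tau>, of "(l, v)" n l' v'] lv c unfolding \<rho>_def by auto
    next
      case False
      then show ?thesis using play_weight_no_goal[OF \<sigma> \<tau>, of "(l, v)"] c unfolding \<rho>_def by auto
    qed
  qed
  then have "M \<le> (SUP \<tau> \<in> max_strategies K. play_weight K \<sigma> \<tau> (l, v))" if "\<sigma> \<in> min_strategies K" for \<sigma>
    using \<tau> that by (meson SUP_upper2)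
  then show "M \<le> Val K l v" unfolding Val_def by (rule INF_greatest)
qed

end

section \<open>Candidate values\<close>

text \<open>Infimum or supremum, not necessarily attained, in one predicate, so that the analysis of
  a transition is carried out once for both players.\<close>

definition is_extremum :: "real set \<Rightarrow> (real \<Rightarrow> real) \<Rightarrow> real \<Rightarrow> bool" where
  "is_extremum D f m \<longleftrightarrow>
     (\<forall>d\<in>D. m \<le> f d) \<and> (\<forall>e>0. \<exists>d\<in>D. f d < m + e) \<or>
     (\<forall>d\<in>D. f d \<le> m) \<and> (\<forall>e>0. \<exists>d\<in>D. m - e < f d)"

lemma is_extremum_const:
  assumes "is_extremum D f m" "\<And>d. d \<in> D \<Longrightarrow> f d = c" "D \<noteq> {}"
  shows "m = c"
proof -
  obtain d where d: "d \<in> D" using assms(3) by blast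
  consider "m \<le> c" "\<And>e. e > 0 \<Longrightarrow> c < m + e" | "c \<le> m" "\<And>e. e > 0 \<Longrightarrow> m - e < c"
    using assms(1) assms(2) d unfolding is_extremum_def by metis
  then show ?thesis
  proof cases
    case 1
    then show ?thesis using 1(2)[of "c - m"] by linarith
  next
    case 2
    then show ?thesis using 2(2)[of "m - c"] by linarith
  qed
qed

lemma is_extremum_uminus: "is_extremum D (\<lambda>d. - f d) (- m) \<longleftrightarrow> is_extremum D f m"
proof -
  have "- f d < - m + e \<longleftrightarrow> m - e < f d" "- m - e < - f d \<longleftrightarrow> f d < m + e" for d e by auto
  then show ?thesis unfolding is_extremum_def by auto
qed

lemma selection_extremum:
  assumes "finite U" "\<And>u. u \<in> U \<Longrightarrow> affine_fn u" "selection D U f"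
    and "D \<subseteq> {p..q}" "{p<..<q} \<subseteq> D" "is_extremum D f m"
  shows "(\<exists>u\<in>U. m = u p \<or> m = u q) \<or> (\<exists>u\<in>U. \<exists>v\<in>U. \<exists>s. u \<noteq> v \<and> u s = m \<and> v s = m)"
  using assms(6) selection_infimum[OF assms(1-5), of m] selection_supremum[OF assms(1-5), of m]
  unfolding is_extremum_def by blast

text \<open>Take \<open>a\<close> nearly optimal and \<open>b\<close> in \<open>D\<close> near the
  relevant end; the one of \<open>a\<close>, \<open>b\<close> closer to that end is near it and
  still nearly optimal by monotonicity. Approach of \<open>d\<close> and \<open>f d\<close> at the
  same time is what a closed-graph argument needs, as \<open>f\<close> has no meaning at an excluded
  end.\<close>

lemma mono_extremum_aux:
  assumes f: "\<And>s t. s \<in> D \<Longrightarrow> t \<in> D \<Longrightarrow> s \<le> t \<Longrightarrow> f s \<le> (f t :: real)"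
    and D: "D \<subseteq> {p..q}" "p \<in> closure D" "q \<in> closure D" and m: "is_extremum D f m"
  shows "\<exists>c\<in>{p, q}. \<forall>e>0. \<exists>d\<in>D. \<bar>d - c\<bar> < e \<and> \<bar>f d - m\<bar> < e"
  using m unfolding is_extremum_def
proof
  assume m: "(\<forall>d\<in>D. m \<le> f d) \<and> (\<forall>e>0. \<exists>d\<in>D. f d < m + e)"
  have "\<exists>d\<in>D. \<bar>d - p\<bar> < e \<and> \<bar>f d - m\<bar> < e" if "e > 0" for e
  proof -
    obtain a where a: "a \<in> D" "f a < m + e" using m \<open>e > 0\<close> by blast
    obtain b where b: "b \<in> D" "\<bar>b - p\<bar> < e"
      using D(2) \<open>e > 0\<close> unfolding closure_approachable by (auto simp: dist_real_def)
    define d where "d = min a b"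
    have "d \<in> D" unfolding d_def using a b by (auto simp: min_def)
    moreover have "f d \<le> f a" using f[OF \<open>d \<in> D\<close> a(1)] unfolding d_def by simp
    moreover have "p \<le> d" "d \<le> b" using \<open>d \<in> D\<close> D(1) unfolding d_def by auto
    ultimately show ?thesis using a b m by (intro bexI[of _ d]) (auto simp: abs_less_iff)
  qed
  then show ?thesis by blast
next
  assume m: "(\<forall>d\<in>D. f d \<le> m) \<and> (\<forall>e>0. \<exists>d\<in>D. m - e < f d)"
  have "\<exists>d\<in>D. \<bar>d - q\<bar> < e \<and> \<bar>f d - m\<bar> < e" if "e > 0" for e
  proof -
    obtain a where a: "a \<in> D" "m - e < f a" using m \<open>e > 0\<close> by blast
    obtain b where b: "b \<in> D" "\<bar>b - q\<bar> < e"
      using D(3) \<open>e > 0\<close> unfolding closure_approachable by (auto simp: dist_real_def)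
    define d where "d = max a b"
    have "d \<in> D" unfolding d_def using a b by (auto simp: max_def)
    moreover have "f a \<le> f d" using f[OF a(1) \<open>d \<in> D\<close>] unfolding d_def by simp
    moreover have "d \<le> q" "b \<le> d" using \<open>d \<in> D\<close> D(1) unfolding d_def by auto
    ultimately show ?thesis using a b m by (intro bexI[of _ d]) (auto simp: abs_less_iff)
  qed
  then show ?thesis by blast
qed

lemma monotone_extremum:
  assumes f: "(\<forall>s\<in>D. \<forall>t\<in>D. s \<le> t \<longrightarrow> f s \<le> (f t :: real)) \<or> (\<forall>s\<in>D. \<forall>t\<in>D. s \<le> t \<longrightarrow> f t \<le> f s)"
    and D: "D \<subseteq> {p..q}" "p \<in> closure D" "q \<in> closure D" and m: "is_extremum D f m"
  obtains c where "c \<in> {p, q}" "\<And>e. e > 0 \<Longrightarrow> \<exists>d\<in>D. \<bar>d - c\<bar> < e \<and> \<bar>f d - m\<bar> < e"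
proof -
  have "\<exists>c\<in>{p, q}. \<forall>e>0. \<exists>d\<in>D. \<bar>d - c\<bar> < e \<and> \<bar>f d - m\<bar> < e"
    using f
  proof
    assume "\<forall>s\<in>D. \<forall>t\<in>D. s \<le> t \<longrightarrow> f s \<le> f t"
    then show ?thesis using mono_extremum_aux[OF _ D m] by blast
  next
    assume "\<forall>s\<in>D. \<forall>t\<in>D. s \<le> t \<longrightarrow> f t \<le> f s"
    then have "\<exists>c\<in>{p, q}. \<forall>e>0. \<exists>d\<in>D. \<bar>d - c\<bar> < e \<and> \<bar>- f d - (- m)\<bar> < e"
      using mono_extremum_aux[OF _ D, of "\<lambda>d. - f d" "- m"] m by (simp add: is_extremum_uminus)
    then show ?thesis by (simp add: abs_minus_commute)
  qed
  then show ?thesis using that by blast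
qed

section \<open>Parameters and candidate values\<close>

definition unit_cube :: "'c::finite valuation set" where
  "unit_cube = {v. \<forall>c. 0 \<le> v $ c \<and> v $ c \<le> 1}"

text \<open>The coordinates in \<open>[0,1]\<close> that the game can still show when some other clock is integral.\<close>

definition params :: "'c::finite valuation \<Rightarrow> real set" where
  "params v = {s. 0 \<le> s \<and> s \<le> 1 \<and>
     (\<exists>n::int. (\<exists>z. s = n + v $ z) \<or> (\<exists>z x. s = n + (v $ z - v $ x)))}"

text \<open>Functions in \<open>G\<close> serve while both clocks matter; functions in
  \<open>U\<close> of one parameter serve once a clock has been reset or has met an integer.\<close>

definition cands :: "('c::finite valuation \<Rightarrow> real) set \<Rightarrow> (real \<Rightarrow> real) set \<Rightarrow> 'c valuation \<Rightarrow> real set" where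
  "cands G U v = {g v | g. g \<in> G} \<union> {u s | u s. u \<in> U \<and> s \<in> params v}"

text \<open>With two clocks, \<open>n\<close> in {0,1} and \<open>s\<close> in [0,1], these are the
  points on the edges of the unit square.\<close>

definition edge_point :: "'c::finite \<Rightarrow> real \<Rightarrow> real \<Rightarrow> 'c valuation" where
  "edge_point z n s = (\<chi> c. if c = z then n else s)"

text \<open>Restriction to edges serves delays ending with an integral clock. Reflection and the
  value at 0 cover the parameters 0, 1, \<open>s\<close> and \<open>1 - s\<close> visible from an
  edge point. Crossing values become constants because they can be extrema after a reset.\<close>

definition boundary_closed :: "('c::finite valuation \<Rightarrow> real) set \<Rightarrow> (real \<Rightarrow> real) set \<Rightarrow> bool" where
  "boundary_closed G U \<longleftrightarrow>
     (\<forall>g\<in>G. \<forall>z. \<forall>n\<in>{0, 1}. (\<lambda>s. g (edge_point z n s)) \<in> U) \<and>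
     (\<forall>u\<in>U. (\<lambda>s. u (1 - s)) \<in> U \<and> (\<lambda>_. u 0) \<in> U) \<and>
     (\<forall>u\<in>U. \<forall>v\<in>U. \<forall>s. u \<noteq> v \<and> u s = v s \<longrightarrow> (\<lambda>_. u s) \<in> U)"

lemma affine_fn_reflect: "affine_fn u \<Longrightarrow> affine_fn (\<lambda>s::real. u (c - s))"
proof -
  assume "affine_fn u"
  then obtain a b where "\<And>s. u s = a * s + b" unfolding affine_fn_def by auto
  then have "\<And>s. u (c - s) = - a \<bullet> s + (a * c + b)" by (simp add: algebra_simps)
  then show ?thesis unfolding affine_fn_def by blast
qed

lemma affine_fn_compose:
  fixes u :: "real \<Rightarrow> real" and g :: "'a::euclidean_space \<Rightarrow> real"
  assumes "affine_fn u" "affine_fn g" shows "affine_fn (\<lambda>v. u (g v))"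
proof -
  obtain a b where "\<And>s. u s = a * s + b" using assms(1) unfolding affine_fn_def by auto
  moreover obtain c d where "\<And>v. g v = c \<bullet> v + d" using assms(2) unfolding affine_fn_def by auto
  ultimately have "\<And>v. u (g v) = (a *\<^sub>R c) \<bullet> v + (a * d + b)" by (simp add: algebra_simps)
  then show ?thesis unfolding affine_fn_def by blast
qed

lemma delay_eq: "delay v d = v + d *\<^sub>R (\<chi> c. 1)"
  by (simp add: delay_def vec_eq_iff)

lemma delay_0 [simp]: "delay v 0 = v"
  by (simp add: delay_def vec_eq_iff)

lemma delay_delay [simp]: "delay (delay v s) t = delay v (s + t)"
  by (simp add: delay_def vec_eq_iff)

lemma affine_fn_delay:
  assumes "affine_fn g" shows "affine_fn (\<lambda>d. g (delay v d))"
proof -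
  obtain a b where "\<And>v. g v = a \<bullet> v + b" using assms unfolding affine_fn_def by auto
  then have "\<And>d. g (delay v d) = (a \<bullet> (\<chi> c. 1)) \<bullet> d + (a \<bullet> v + b)"
    unfolding delay_eq by (simp add: inner_add_right algebra_simps)
  then show ?thesis unfolding affine_fn_def by blast
qed

lemma affine_fn_edge_point:
  assumes "affine_fn g" shows "affine_fn (\<lambda>s. g (edge_point z n s))"
proof -
  obtain a b where *: "\<And>v. g v = a \<bullet> v + b" using assms unfolding affine_fn_def by auto
  have e: "edge_point z n s = edge_point z n 0 + s *\<^sub>R edge_point z 0 1" for s
    by (simp add: edge_point_def vec_eq_iff)
  have "g (edge_point z n s) = (a \<bullet> edge_point z 0 1) \<bullet> s + (a \<bullet> edge_point z n 0 + b)" for s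
    unfolding e[of s] * by (simp add: inner_add_right)
  then show ?thesis unfolding affine_fn_def by blast
qed

lemma affine_crossing_unique:
  fixes u v :: "real \<Rightarrow> real"
  assumes "affine_fn u" "affine_fn v" "u \<noteq> v" "u s = v s" "u t = v t"
  shows "s = t"
proof (rule ccontr)
  assume st: "s \<noteq> t"
  obtain a b where u: "\<And>s. u s = a * s + b" using assms(1) unfolding affine_fn_def by auto
  obtain c d where v: "\<And>s. v s = c * s + d" using assms(2) unfolding affine_fn_def by auto
  have "(a - c) * (s - t) = 0" using assms(4,5) by (simp add: u v algebra_simps)
  then have "a = c" using st by simp
  then have "b = d" using assms(4) by (simp add: u v)
  then have "u = v" using \<open>a = c\<close> by (auto simp: u v)
  then show False using assms(3) by simp
qed

text \<open>One round of closure is enough: reflection is an involution fixing constants, and a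
  crossing with a constant function has that constant as its value. So only crossings within
  \<open>U0\<close> have to be added.\<close>

lemma exists_boundary_closed:
  fixes G :: "('c::finite valuation \<Rightarrow> real) set"
  assumes G: "finite G" "\<And>g. g \<in> G \<Longrightarrow> affine_fn g"
  obtains U where "finite U" "\<And>u. u \<in> U \<Longrightarrow> affine_fn u" "boundary_closed G U"
proof -
  define B where "B = (\<lambda>(g, z, n) s. g (edge_point z n s)) ` (G \<times> (UNIV :: 'c set) \<times> {0, 1})"
  define U0 where "U0 = B \<union> (\<lambda>u s. u (1 - s)) ` B"
  define C where "C = {c. \<exists>u\<in>U0. \<exists>v\<in>U0. \<exists>s. u \<noteq> v \<and> u s = v s \<and> c = u s} \<union> (\<lambda>u. u 0) ` U0"
  define U where "U = U0 \<union> (\<lambda>c _. c) ` C"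
  have fU0: "finite U0" unfolding U0_def B_def using G by auto
  have aU0: "affine_fn u" if "u \<in> U0" for u
    using that G unfolding U0_def B_def by (auto intro!: affine_fn_edge_point affine_fn_reflect)
  \<comment> \<open>Distinct affine functions of one variable meet at most once, so a pair
    determines its crossing value.\<close>
  have "{c. \<exists>u\<in>U0. \<exists>v\<in>U0. \<exists>s. u \<noteq> v \<and> u s = v s \<and> c = u s}
      \<subseteq> (\<lambda>(u, v). u (THE s. u s = v s)) ` (U0 \<times> U0)"
  proof
    fix c assume "c \<in> {c. \<exists>u\<in>U0. \<exists>v\<in>U0. \<exists>s. u \<noteq> v \<and> u s = v s \<and> c = u s}"
    then obtain u v s where uv: "u \<in> U0" "v \<in> U0" "u \<noteq> v" "u s = v s" "c = u s" by blast
    have "(THE t. u t = v t) = s"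
      by (rule the_equality, rule uv(4), rule affine_crossing_unique[OF aU0[OF uv(1)] aU0[OF uv(2)] uv(3) _ uv(4)])
    then show "c \<in> (\<lambda>(u, v). u (THE s. u s = v s)) ` (U0 \<times> U0)"
      using uv by (intro image_eqI[of _ _ "(u, v)"]) auto
  qed
  then have fC: "finite C"
    unfolding C_def by (intro finite_UnI finite_imageI fU0) (rule finite_subset, assumption, simp add: fU0)
  have refl: "(\<lambda>s. u (1 - s)) \<in> U0" if "u \<in> U0" for u
    using that unfolding U0_def by auto
  have constC: "(\<lambda>_. c) \<in> U" if "c \<in> C" for c using that unfolding U_def by blast
  have UE: "u \<in> U0 \<or> (\<exists>c\<in>C. u = (\<lambda>_. c))" if "u \<in> U" for u using that unfolding U_def by blast
  have "(\<lambda>s. g (edge_point z n s)) \<in> U" if "g \<in> G" "n \<in> {0, 1}" for g z n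
    using that unfolding U_def U0_def B_def
    by (intro UnI1 image_eqI[of _ _ "(g, z, n)"]) auto
  moreover have "(\<lambda>s. u (1 - s)) \<in> U" if "u \<in> U" for u
    using UE[OF that] refl[of u] constC unfolding U_def by auto
  moreover have "(\<lambda>_. u 0) \<in> U" if "u \<in> U" for u
  proof -
    have "u 0 \<in> C" if "u \<in> U0" using that unfolding C_def by blast
    then show ?thesis using UE[OF \<open>u \<in> U\<close>] constC by auto
  qed
  moreover have "(\<lambda>_. u s) \<in> U" if uv: "u \<in> U" "v \<in> U" "u \<noteq> v" "u s = v s" for u v s
  proof (cases "u \<in> U0 \<and> v \<in> U0")
    case True
    then have "u s \<in> C" unfolding C_def using uv by blast
    then show ?thesis by (rule constC)
  next
    case False
    then obtain c where "c \<in> C" "u = (\<lambda>_. c) \<or> v = (\<lambda>_. c)" using UE uv(1,2) by blast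
    then have "c \<in> C" "u s = c" using uv(4) by auto
    then show ?thesis using constC by simp
  qed
  ultimately have "boundary_closed G U" unfolding boundary_closed_def by blast
  moreover have "affine_fn u" if "u \<in> U" for u using that aU0 unfolding U_def by auto
  moreover have "finite U" unfolding U_def using fU0 fC by blast
  ultimately show ?thesis using that[of U] by blast
qed

lemma params_zero: "0 \<in> params v"
proof -
  have "(0::real) = of_int 0 + (v $ z - v $ z)" for z by simp
  then show ?thesis unfolding params_def using zero_le_one order_refl by blast
qed

lemma params_clock: "v \<in> unit_cube \<Longrightarrow> v $ z \<in> params v"
  unfolding params_def unit_cube_def by (auto intro!: exI[of _ 0])

text \<open>Differences are invariant under delays. If clock \<open>c\<close> reaches the integer
  \<open>N\<close>, then \<open>p = N - v $ c\<close>, which turns a delayed coordinate into a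
  difference plus an integer.\<close>

lemma params_delay: assumes "event v p" shows "params (delay v p) \<subseteq> params v"
proof
  fix s assume s: "s \<in> params (delay v p)"
  then obtain n :: int where n: "(\<exists>z. s = n + (v $ z + p)) \<or> (\<exists>z x. s = n + (v $ z - v $ x))" and
    s01: "0 \<le> s" "s \<le> 1"
    unfolding params_def delay_def by auto
  have "\<exists>n::int. (\<exists>z. s = n + v $ z) \<or> (\<exists>z x. s = n + (v $ z - v $ x))"
  proof (cases "p = 0")
    case True then show ?thesis using n by auto
  next
    case False
    then obtain c and N :: int where "v $ c + p = N" using assms unfolding event_def by blast
    then have "n + (v $ z + p) = (n + N) + (v $ z - v $ c)" for z by simp
    then show ?thesis using n by (metis of_int_add)
  qed
  then show "s \<in> params v" using s01 unfolding params_def by blast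
qed

lemma params_edge_point:
  assumes s: "0 \<le> s" "s \<le> 1" and t: "t \<in> params (edge_point z 0 s)"
  shows "t \<in> {0, 1, s, 1 - s}"
proof -
  obtain n :: int where n: "t = n \<or> t = n + s \<or> t = n - s" and t01: "0 \<le> t" "t \<le> 1"
    using t unfolding params_def edge_point_def by (auto split: if_splits)
  \<comment> \<open>Offsets -1 and 2 fit into [0,1] only for \<open>s = 1\<close>, where they give 0
    and 1.\<close>
  have "n \<le> -2 \<or> n = -1 \<or> n = 0 \<or> n = 1 \<or> n = 2 \<or> n \<ge> 3" by linarith
  moreover have "real_of_int n \<le> -2" if "n \<le> -2" using that by linarith
  moreover have "real_of_int n \<ge> 3" if "n \<ge> 3" using that by linarith
  ultimately show ?thesis using n t01 s by auto
qed

lemma two_clocks: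
  assumes "CARD('c::finite) = 2" and "(x::'c) \<noteq> z" shows "c = x \<or> c = z"
proof -
  have "{x, z} = UNIV" using assms by (intro card_subset_eq) auto
  then show ?thesis by auto
qed

lemma exists_other_clock:
  assumes "CARD('c::finite) = 2" obtains z where "z \<noteq> (x::'c)"
proof -
  have "UNIV \<noteq> {x}" using assms by (metis One_nat_def card.empty card.insert empty_iff finite.emptyI n_not_Suc_n numeral_2_eq_2)
  then show ?thesis using that by blast
qed

text \<open>After a reset of one clock the candidates become values of finitely many affine
  functions at the surviving coordinate, so the extremum lemmas for selections apply.\<close>

lemma cands_edge_point:
  assumes bc: "boundary_closed G U" and s: "0 \<le> s" "s \<le> 1"
  shows "cands G U (edge_point z 0 s) \<subseteq> {u s | u. u \<in> U}"
proof
  fix y assume "y \<in> cands G U (edge_point z 0 s)"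
  then consider g where "g \<in> G" "y = g (edge_point z 0 s)"
    | u t where "u \<in> U" "t \<in> params (edge_point z 0 s)" "y = u t"
    unfolding cands_def by auto
  then show "y \<in> {u s | u. u \<in> U}"
  proof cases
    case 1
    then have "(\<lambda>s. g (edge_point z 0 s)) \<in> U" using bc unfolding boundary_closed_def by auto
    then show ?thesis using 1 by auto
  next
    case 2
    have r: "(\<lambda>s. u (1 - s)) \<in> U" "(\<lambda>_. u 0) \<in> U" using bc 2 unfolding boundary_closed_def by auto
    then have "(\<lambda>_. u 1) \<in> U" using bc unfolding boundary_closed_def by force
    then show ?thesis using params_edge_point[OF s 2(2)] r 2 by auto
  qed
qed

lemma cands_fn: "g \<in> G \<Longrightarrow> g v \<in> cands G U v"
  unfolding cands_def by blast

lemma cands_param: "u \<in> U \<Longrightarrow> s \<in> params v \<Longrightarrow> u s \<in> cands G U v"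
  unfolding cands_def by blast

lemma cands_const:
  assumes "(\<lambda>_. m) \<in> U" shows "m \<in> cands G U v"
  unfolding cands_def using assms params_zero[of v] by auto

text \<open>A nonzero event delay ends on an edge of the square. There a function of
  \<open>G\<close> is a function of \<open>U\<close> in the other clock, and that clock is a
  parameter of \<open>v\<close>. Hence delaying to an event creates no new candidates.\<close>

lemma cands_delay:
  fixes v :: "'c::finite valuation"
  assumes card: "CARD('c) = 2" and bc: "boundary_closed G U"
    and ev: "event v p" and unit: "delay v p \<in> unit_cube"
  shows "cands G U (delay v p) \<subseteq> cands G U v"
proof (cases "p = 0")
  case False
  then obtain z and N :: int where zN: "v $ z + p = N" using ev unfolding event_def by blast
  obtain x where x: "x \<noteq> z" using exists_other_clock[OF card] by blast
  have "0 \<le> delay v p $ z" "delay v p $ z \<le> 1" using unit unfolding unit_cube_def by blast+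
  then have N: "N = 0 \<or> N = 1" using zN by (auto simp: delay_def)
  have eq: "delay v p = edge_point z N (delay v p $ x)"
  proof (subst vec_eq_iff, rule allI)
    fix c
    show "delay v p $ c = edge_point z N (delay v p $ x) $ c"
      using two_clocks[OF card x, of c] zN by (auto simp: delay_def edge_point_def)
  qed
  have par: "params (delay v p) \<subseteq> params v" by (rule params_delay[OF ev])
  have "g (delay v p) \<in> cands G U v" if "g \<in> G" for g
  proof -
    have "(\<lambda>s. g (edge_point z N s)) \<in> U" using bc that N unfolding boundary_closed_def by auto
    moreover have "delay v p $ x \<in> params v" using params_clock[OF unit] par by blast
    ultimately have "(\<lambda>s. g (edge_point z N s)) (delay v p $ x) \<in> cands G U v"
      by (rule cands_param)
    then show ?thesis using eq by simp
  qed
  then show ?thesis using par unfolding cands_def by blast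
qed simp

text \<open>The range covers all offsets that occur: the parameter lies in [0,1] and a clock or
  difference in [-1,1], so the offset is between -1 and 2.\<close>

definition param_fns :: "('c::finite valuation \<Rightarrow> real) set" where
  "param_fns = (\<lambda>(n::int, z) v. n + v $ z) ` ({-2..2} \<times> UNIV) \<union>
     (\<lambda>(n::int, z, x) v. n + (v $ z - v $ x)) ` ({-2..2} \<times> UNIV \<times> UNIV)"

lemma finite_param_fns: "finite param_fns"
  unfolding param_fns_def by auto

lemma affine_param_fns:
  assumes "\<pi> \<in> (param_fns :: ('c::finite valuation \<Rightarrow> real) set)" shows "affine_fn \<pi>"
proof -
  have "affine_fn (\<lambda>v::'c valuation. n + v $ z)" for n :: real and z
    unfolding affine_fn_def by (intro exI[of _ "axis z 1"] exI[of _ n]) (simp add: inner_axis' )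
  moreover have "affine_fn (\<lambda>v::'c valuation. n + (v $ z - v $ x))" for n :: real and z x
    unfolding affine_fn_def
    by (intro exI[of _ "axis z 1 - axis x 1"] exI[of _ n]) (simp add: inner_axis' inner_diff_left)
  ultimately show ?thesis using assms unfolding param_fns_def by auto
qed

lemma param_fns_memI:
  fixes z x :: "'c::finite"
  assumes "(n::int) \<in> {-2..2}"
  shows "(\<lambda>v::'c valuation. of_int n + v $ z) \<in> param_fns"
    and "(\<lambda>v::'c valuation. of_int n + (v $ z - v $ x)) \<in> param_fns"
proof -
  have "(n, z) \<in> {-2..2} \<times> UNIV" "(n, z, x) \<in> {-2..2} \<times> UNIV \<times> UNIV" using assms by auto
  note * = this(1)[THEN imageI, of "\<lambda>(n, z) (v::'c valuation). of_int n + v $ z"]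
    this(2)[THEN imageI, of "\<lambda>(n, z, x) (v::'c valuation). of_int n + (v $ z - v $ x)"]
  show "(\<lambda>v::'c valuation. of_int n + v $ z) \<in> param_fns"
    using *(1) unfolding param_fns_def prod.case by (rule UnI1)
  show "(\<lambda>v::'c valuation. of_int n + (v $ z - v $ x)) \<in> param_fns"
    using *(2) unfolding param_fns_def prod.case by (rule UnI2)
qed

lemma params_unit_cube:
  assumes v: "v \<in> unit_cube"
  shows "params v = {\<pi> v | \<pi>. \<pi> \<in> param_fns \<and> 0 \<le> \<pi> v \<and> \<pi> v \<le> 1}"
proof
  show "params v \<subseteq> {\<pi> v | \<pi>. \<pi> \<in> param_fns \<and> 0 \<le> \<pi> v \<and> \<pi> v \<le> 1}"
  proof
    fix s assume s: "s \<in> params v"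
    have v01: "0 \<le> v $ c" "v $ c \<le> 1" for c using v unfolding unit_cube_def by auto
    obtain n :: int where n: "(\<exists>z. s = n + v $ z) \<or> (\<exists>z x. s = n + (v $ z - v $ x))"
      and s01: "0 \<le> s" "s \<le> 1" using s unfolding params_def by blast
    have "-2 \<le> real_of_int n" "real_of_int n \<le> 2"
      using n s01 v01 by (smt (verit))+
    then have n2: "n \<in> {-2..2}" by auto
    note mem = param_fns_memI[OF n2]
    show "s \<in> {\<pi> v | \<pi>. \<pi> \<in> param_fns \<and> 0 \<le> \<pi> v \<and> \<pi> v \<le> 1}"
    proof -
      consider z where "s = n + v $ z" | z x where "s = n + (v $ z - v $ x)" using n by blast
      then have "\<exists>\<pi>\<in>param_fns. s = \<pi> v"
      proof cases
        case 1
        show ?thesis by (rule rev_bexI[OF mem(1)[of z]]) (rule 1)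
      next
        case 2
        show ?thesis by (rule rev_bexI[OF mem(2)[of z x]]) (rule 2)
      qed
      then show ?thesis using s01 by blast
    qed
  qed
qed (auto simp: params_def param_fns_def)

text \<open>Forgetting that parameters lie in [0,1] turns the candidates into a finite family of
  affine functions on the whole space.\<close>

definition cand_fns :: "('c::finite valuation \<Rightarrow> real) set \<Rightarrow> (real \<Rightarrow> real) set \<Rightarrow> ('c valuation \<Rightarrow> real) set" where
  "cand_fns G U = G \<union> (\<lambda>(u, \<pi>) v. u (\<pi> v)) ` (U \<times> param_fns)"

lemma finite_cand_fns: "finite G \<Longrightarrow> finite U \<Longrightarrow> finite (cand_fns G U)"
  unfolding cand_fns_def using finite_param_fns by auto

lemma affine_cand_fns:
  "(\<And>g. g \<in> G \<Longrightarrow> affine_fn g) \<Longrightarrow> (\<And>u. u \<in> U \<Longrightarrow> affine_fn u) \<Longrightarrow> g \<in> cand_fns G U \<Longrightarrow> affine_fn g"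
  unfolding cand_fns_def by (auto intro: affine_fn_compose affine_param_fns)

lemma cands_cand_fns:
  "v \<in> unit_cube \<Longrightarrow> y \<in> cands G U v \<Longrightarrow> \<exists>g\<in>cand_fns G U. y = g v"
  unfolding cands_def cand_fns_def params_unit_cube by force

lemma closed_affine_graph:
  fixes f p :: "real \<Rightarrow> real"
  assumes "affine_fn f"
  shows "closed {z. snd z = f (fst z)}"
    and "affine_fn p \<Longrightarrow> closed {z. snd z = f (fst z) \<and> 0 \<le> p (fst z) \<and> p (fst z) \<le> 1}"
proof -
  obtain a b where f: "\<And>s. f s = a * s + b" using assms unfolding affine_fn_def by auto
  show *: "closed {z. snd z = f (fst z)}"
    unfolding f by (intro closed_Collect_eq continuous_intros)
  assume "affine_fn p"
  then obtain c d where p: "\<And>s. p s = c * s + d" unfolding affine_fn_def by auto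
  have "closed {z :: real \<times> real. 0 \<le> p (fst z)}" "closed {z :: real \<times> real. p (fst z) \<le> 1}"
    unfolding p by (intro closed_Collect_le continuous_intros)+
  with * show "closed {z. snd z = f (fst z) \<and> 0 \<le> p (fst z) \<and> p (fst z) \<le> 1}"
    by (intro closed_Collect_conj)
qed

text \<open>Over the delays, the graph of the candidate sets is a finite union of closed sets,
  because parameters are constrained by weak inequalities. So candidates survive the limit at an
  excluded end of a guard interval.\<close>

lemma cands_limit:
  fixes v :: "'c::finite valuation"
  assumes G: "finite G" "\<And>g. g \<in> G \<Longrightarrow> affine_fn g" and U: "finite U" "\<And>u. u \<in> U \<Longrightarrow> affine_fn u"
    and D: "\<And>d. d \<in> D \<Longrightarrow> delay v d \<in> unit_cube \<and> f d \<in> cands G U (delay v d)"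
    and lim: "\<And>e. e > 0 \<Longrightarrow> \<exists>d\<in>D. \<bar>d - p\<bar> < e \<and> \<bar>f d - m\<bar> < e"
  shows "delay v p \<in> unit_cube" "m \<in> cands G U (delay v p)"
proof -
  define W where "W = (\<Union>g\<in>G. {z. snd z = g (delay v (fst z))}) \<union>
     (\<Union>(u, \<pi>)\<in>U \<times> (param_fns :: ('c valuation \<Rightarrow> real) set). {z. snd z = u (\<pi> (delay v (fst z))) \<and> 0 \<le> \<pi> (delay v (fst z)) \<and> \<pi> (delay v (fst z)) \<le> 1})"
  have "closed W" unfolding W_def
  proof (intro closed_Un closed_UN ballI)
    fix g assume "g \<in> G"
    then show "closed {z. snd z = g (delay v (fst z))}"
      using closed_affine_graph(1)[OF affine_fn_delay[OF G(2)]] by simp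
  next
    fix p assume "p \<in> U \<times> (param_fns :: ('c valuation \<Rightarrow> real) set)"
    then obtain u \<pi> where p: "p = (u, \<pi>)" "affine_fn u" "affine_fn \<pi>" using U affine_param_fns by auto
    show "closed (case p of (u, \<pi>) \<Rightarrow> {z. snd z = u (\<pi> (delay v (fst z))) \<and>
       0 \<le> \<pi> (delay v (fst z)) \<and> \<pi> (delay v (fst z)) \<le> 1})"
      unfolding p(1) prod.case
      by (rule closed_affine_graph(2)[where f = "\<lambda>d. u (\<pi> (delay v d))" and p = "\<lambda>d. \<pi> (delay v d)"])
         (rule affine_fn_delay[OF affine_fn_compose[OF p(2,3)]] affine_fn_delay[OF p(3)])+
  qed (simp_all add: G(1) U(1) finite_param_fns)
  moreover have "closed {z :: real \<times> real. delay v (fst z) \<in> unit_cube}"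
    unfolding unit_cube_def delay_def
    by (auto intro!: closed_Collect_all closed_Collect_conj closed_Collect_le continuous_intros)
  ultimately have "closed (W \<inter> {z. delay v (fst z) \<in> unit_cube})" by (rule closed_Int)
  moreover have W: "(d, y) \<in> W \<longleftrightarrow> y \<in> cands G U (delay v d)" if "delay v d \<in> unit_cube" for d y
    unfolding W_def cands_def params_unit_cube[OF that] by auto
  have "(p, m) \<in> closure (W \<inter> {z. delay v (fst z) \<in> unit_cube})"
    unfolding closure_approachable
  proof (intro allI impI)
    fix e :: real assume "e > 0"
    then obtain d where d: "d \<in> D" "\<bar>d - p\<bar> < e/2" "\<bar>f d - m\<bar> < e/2" using lim[of "e/2"] by auto
    have "dist (d, f d) (p, m) \<le> \<bar>d - p\<bar> + \<bar>f d - m\<bar>"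
      unfolding dist_Pair_Pair dist_real_def using sqrt_sum_squares_le_sum_abs[of "d - p" "f d - m"] by simp
    then have "dist (d, f d) (p, m) < e" using d by simp
    then show "\<exists>y\<in>W \<inter> {z. delay v (fst z) \<in> unit_cube}. dist y (p, m) < e"
      using D[OF d(1)] W by (intro bexI[of _ "(d, f d)"]) auto
  qed
  ultimately have "(p, m) \<in> W \<inter> {z. delay v (fst z) \<in> unit_cube}" by simp
  then show "delay v p \<in> unit_cube" "m \<in> cands G U (delay v p)" using W by auto
qed

section \<open>Crossings along diagonals\<close>

definition diagonal_crossings :: "('c::finite valuation \<Rightarrow> real) set \<Rightarrow> ('c valuation \<Rightarrow> real) set \<Rightarrow> bool" where
  "diagonal_crossings H G \<longleftrightarrow>
     (\<forall>g\<in>H. \<forall>h\<in>H. \<forall>v s. (\<lambda>d. g (delay v d)) \<noteq> (\<lambda>d. h (delay v d)) \<longrightarrow>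
        g (delay v s) = h (delay v s) \<longrightarrow> (\<exists>f\<in>G. f v = g (delay v s)))"

lemma diagonal_crossingsD:
  assumes "diagonal_crossings H G" "g \<in> H" "h \<in> H" "(\<lambda>d. g (delay v d)) \<noteq> (\<lambda>d. h (delay v d))"
    "g (delay v s) = h (delay v s)"
  shows "\<exists>f\<in>G. f v = g (delay v s)"
  using assms(1)[unfolded diagonal_crossings_def, rule_format, OF assms(2-5)] .

lemma diagonal_crossings_subset:
  assumes "diagonal_crossings H G" "H' \<subseteq> H" shows "diagonal_crossings H' G"
  unfolding diagonal_crossings_def
proof (intro ballI allI impI)
  fix g h v s assume "g \<in> H'" "h \<in> H'" "(\<lambda>d. g (delay v d)) \<noteq> (\<lambda>d. h (delay v d))"
    "g (delay v s) = h (delay v s)"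
  then show "\<exists>f\<in>G. f v = g (delay v s)"
    by (intro diagonal_crossingsD[OF assms(1)] subsetD[OF assms(2)])
qed

text \<open>Two affine functions restricted to a diagonal cross at a value that depends affinely on
  the diagonal; adding these finitely many functions accounts for delays into a goal.\<close>

lemma exists_diagonal_crossings:
  fixes H :: "('c::finite valuation \<Rightarrow> real) set"
  assumes H: "finite H" "\<And>g. g \<in> H \<Longrightarrow> affine_fn g"
  obtains G where "finite G" "\<And>g. g \<in> G \<Longrightarrow> affine_fn g" "H \<subseteq> G" "diagonal_crossings H G"
proof -
  \<comment> \<open>The rate of change of an affine function along the diagonal is the same
    everywhere, so it is read off at the origin.\<close>
  define \<beta> where "\<beta> g = g (delay 0 1) - g 0" for g :: "'c valuation \<Rightarrow> real"
  have \<beta>: "g (delay v d) = g v + \<beta> g * d" if g: "affine_fn g" for g v d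
  proof -
    obtain a b where "\<And>v. g v = a \<bullet> v + b" using g unfolding affine_fn_def by auto
    then show ?thesis unfolding \<beta>_def delay_eq by (simp add: inner_add_right)
  qed
  \<comment> \<open>The quotient is the delay at which \<open>g\<close> and \<open>h\<close> meet.
    For equal rates, division by zero gives 0 and \<open>X (g, h) = g\<close>, which is
    harmless.\<close>
  define X where "X = (\<lambda>(g, h) v. g v + \<beta> g * ((h v - g v) / (\<beta> g - \<beta> h)))"
  have aX: "affine_fn (X (g, h))" if "g \<in> H" "h \<in> H" for g h
  proof -
    have "affine_fn g" "affine_fn h" using H that by blast+
    then obtain a b c d where g: "\<And>v. g v = a \<bullet> v + b" and h: "\<And>v. h v = c \<bullet> v + d"
      unfolding affine_fn_def by blast
    define r where "r = \<beta> g / (\<beta> g - \<beta> h)"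
    have "X (g, h) v = (a + r *\<^sub>R (c - a)) \<bullet> v + (b + r * (d - b))" for v
    proof -
      have "X (g, h) v = g v + r * (h v - g v)" unfolding X_def r_def by simp
      then show ?thesis unfolding g h by (simp add: inner_add_left inner_diff_left algebra_simps)
    qed
    then show ?thesis unfolding affine_fn_def by blast
  qed
  have "diagonal_crossings H (H \<union> X ` (H \<times> H))"
    unfolding diagonal_crossings_def
  proof (intro ballI allI impI)
    fix g h and v :: "'c valuation" and s
    assume gh: "g \<in> H" "h \<in> H" "(\<lambda>d. g (delay v d)) \<noteq> (\<lambda>d. h (delay v d))" "g (delay v s) = h (delay v s)"
    have eq: "(\<beta> g - \<beta> h) * s = h v - g v" using gh \<beta> H by (simp add: algebra_simps)
    have "\<beta> g \<noteq> \<beta> h"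
    proof
      assume "\<beta> g = \<beta> h"
      moreover from this have "h v = g v" using eq by simp
      ultimately have "(\<lambda>d. g (delay v d)) = (\<lambda>d. h (delay v d))"
        using \<beta>[OF H(2)[OF gh(1)]] \<beta>[OF H(2)[OF gh(2)]] by simp
      then show False using gh by simp
    qed
    then have "(h v - g v) / (\<beta> g - \<beta> h) = s" using eq by (simp add: field_simps)
    then have "X (g, h) v = g v + \<beta> g * s" by (simp only: X_def prod.case)
    then have "X (g, h) v = g (delay v s)" using \<beta>[OF H(2)[OF gh(1)]] by simp
    then show "\<exists>f\<in>H \<union> X ` (H \<times> H). f v = g (delay v s)" using gh by blast
  qed
  moreover have "affine_fn g" if "g \<in> H \<union> X ` (H \<times> H)" for g using that H aX by auto
  ultimately show ?thesis using that[of "H \<union> X ` (H \<times> H)"] H by blast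
qed

section \<open>Finite convergence of value iteration\<close>

lemma dist_vec_le:
  fixes v w :: "real ^ 'c::finite" and r :: real
  assumes "\<And>c. \<bar>v $ c - w $ c\<bar> \<le> r"
  shows "dist v w \<le> CARD('c) * r"
proof -
  have "dist v w \<le> (\<Sum>c\<in>UNIV. \<bar>(v - w) $ c\<bar>)" unfolding dist_norm by (rule norm_le_l1_cart)
  also have "\<dots> \<le> (\<Sum>c\<in>(UNIV::'c set). r)" using assms by (intro sum_mono) auto
  finally show ?thesis by simp
qed

lemma after_component: "after (d, t) v $ c = (if c \<in> resets t then 0 else v $ c + d)"
  by (simp add: after_def reset_def delay_def)

lemma moves_delay:
  assumes "0 \<le> t" "(d, tr) \<in> moves K (l, delay v t)"
  shows "(t + d, tr) \<in> moves K (l, v)" "after (t + d, tr) v = after (d, tr) (delay v t)"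
  using assms by (auto simp: moves_iff guard_delays_def after_def)

text \<open>Delaying first only removes options, so away from the goals the iterates are monotone along
  delays, and extrema over the delays into such a location are approached at an end of the guard
  interval.\<close>

lemma opt_delay_min:
  assumes "l \<in> min_locs K" "l \<notin> goals K" "0 \<le> t"
  shows "opt K k l v \<le> opt K k l (delay v t)"
proof (cases k)
  case (Suc j)
  have "(INF m \<in> moves K (l, v). opt K j (target (snd m)) (after m v))
      \<le> (INF m \<in> moves K (l, delay v t). opt K j (target (snd m)) (after m (delay v t)))"
  proof (rule INF_mono)
    fix m assume m: "m \<in> moves K (l, delay v t)"
    obtain d tr where "m = (d, tr)" by fastforce
    then show "\<exists>n\<in>moves K (l, v). opt K j (target (snd n)) (after n v) \<le> opt K j (target (snd m)) (after m (delay v t))"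
      using moves_delay[OF assms(3), of d tr K l v] m by (intro bexI[of _ "(t + d, tr)"]) auto
  qed
  then show ?thesis using Suc assms by simp
qed (use assms in simp)

lemma opt_delay_max:
  assumes "l \<notin> min_locs K" "l \<notin> goals K" "0 \<le> t"
  shows "opt K k l (delay v t) \<le> opt K k l v"
proof (cases k)
  case (Suc j)
  have "(SUP m \<in> moves K (l, delay v t). opt K j (target (snd m)) (after m (delay v t)))
      \<le> (SUP m \<in> moves K (l, v). opt K j (target (snd m)) (after m v))"
  proof (rule SUP_mono)
    fix m assume m: "m \<in> moves K (l, delay v t)"
    obtain d tr where "m = (d, tr)" by fastforce
    then show "\<exists>n\<in>moves K (l, v). opt K j (target (snd m)) (after m (delay v t)) \<le> opt K j (target (snd n)) (after n v)"
      using moves_delay[OF assms(3), of d tr K l v] m by (intro bexI[of _ "(t + d, tr)"]) auto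
  qed
  then show ?thesis using Suc assms by simp
qed (use assms in simp)

lemma INF_UN: "(INF x\<in>(\<Union>y\<in>A. g y). f x) = (INF y\<in>A. INF x\<in>g y. f x :: 'b::complete_lattice)"
proof (rule antisym)
  show "(INF x\<in>(\<Union>y\<in>A. g y). f x) \<le> (INF y\<in>A. INF x\<in>g y. f x)"
    by (intro INF_greatest INF_lower) blast
  show "(INF y\<in>A. INF x\<in>g y. f x) \<le> (INF x\<in>(\<Union>y\<in>A. g y). f x)"
    by (rule INF_greatest) (auto intro: INF_lower2 INF_lower)
qed

lemma INF_is_extremum:
  fixes f :: "real \<Rightarrow> real"
  assumes "D \<noteq> {}" "\<And>d. d \<in> D \<Longrightarrow> b \<le> f d"
  obtains m where "(INF d\<in>D. ereal (f d)) = ereal m" "is_extremum D f m"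
proof -
  let ?I = "INF d\<in>D. ereal (f d)"
  obtain d where d: "d \<in> D" using assms(1) by blast
  have "ereal b \<le> ?I" using assms(2) by (intro INF_greatest) auto
  moreover have "?I \<le> ereal (f d)" using d by (rule INF_lower)
  ultimately obtain m where m: "?I = ereal m" by (cases ?I) auto
  have "m \<le> f d" if "d \<in> D" for d using INF_lower[OF that, of "\<lambda>d. ereal (f d)"] m by simp
  moreover have "\<exists>d\<in>D. f d < m + e" if "e > 0" for e
  proof -
    have "?I < ereal (m + e)" using m that by simp
    then show ?thesis unfolding INF_less_iff by simp
  qed
  ultimately show ?thesis using that[OF m] unfolding is_extremum_def by blast
qed

lemma SUP_is_extremum:
  fixes f :: "real \<Rightarrow> real"
  assumes "D \<noteq> {}" "\<And>d. d \<in> D \<Longrightarrow> f d \<le> b"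
  obtains m where "(SUP d\<in>D. ereal (f d)) = ereal m" "is_extremum D f m"
proof -
  let ?I = "SUP d\<in>D. ereal (f d)"
  obtain d where d: "d \<in> D" using assms(1) by blast
  have "?I \<le> ereal b" using assms(2) by (intro SUP_least) auto
  moreover have "ereal (f d) \<le> ?I" using d by (rule SUP_upper)
  ultimately obtain m where m: "?I = ereal m" by (cases ?I) auto
  have "f d \<le> m" if "d \<in> D" for d using SUP_upper[OF that, of "\<lambda>d. ereal (f d)"] m by simp
  moreover have "\<exists>d\<in>D. m - e < f d" if "e > 0" for e
  proof -
    have "ereal (m - e) < ?I" using m that by simp
    then show ?thesis unfolding less_SUP_iff by simp
  qed
  ultimately show ?thesis using that[OF m] unfolding is_extremum_def by blast
qed

text \<open>Crossings are demanded only inside a single \<open>H l\<close>; this avoids closing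
  \<open>G\<close> under its own crossings.\<close>

definition value_family :: "('l, 'c::finite) kernel \<Rightarrow> ('l \<Rightarrow> ('c valuation \<Rightarrow> real) set) \<Rightarrow>
    ('c valuation \<Rightarrow> real) set \<Rightarrow> (real \<Rightarrow> real) set \<Rightarrow> bool" where
  "value_family K H G U \<longleftrightarrow>
     (\<forall>l\<in>goals K. finite (H l) \<and> H l \<subseteq> G \<and> selection (reg K l) (H l) (w_out K l) \<and>
        diagonal_crossings (H l) G) \<and>
     finite G \<and> (\<forall>g\<in>G. affine_fn g) \<and>
     finite U \<and> (\<forall>u\<in>U. affine_fn u) \<and> boundary_closed G U"

section \<open>Lipschitz bounds for the iterates\<close>

context
  fixes K :: "('l, 'c::finite) kernel"
  assumes kernel: "kernel_wtg K"
begin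

text \<open>The factor 2 in the bound on the delays makes the strict inequality of
  \<open>region_delay\<close> available, hence the separate case \<open>v = w\<close>. Adding the
  initial difference of a clock gives 3, and passing from coordinates to the Euclidean distance
  gives the number of clocks.\<close>

lemma moves_match:
  assumes l: "l \<in> locs K" "v \<in> reg K l" "w \<in> reg K l" and m: "(d, t) \<in> moves K (l, w)"
  obtains e where "(e, t) \<in> moves K (l, v)" "dist (after (e, t) v) (after (d, t) w) \<le> CARD('c) * 3 * dist v w"
proof (cases "v = w")
  case True
  then show ?thesis using that m by auto
next
  case False
  have vw: "\<bar>v $ c - w $ c\<bar> \<le> dist v w" for c
    using component_le_norm_cart[of "v - w" c] by (simp add: dist_norm)
  have "region_equiv w v" using clock_region_equiv reg_region[OF kernel] l by blast
  moreover have "0 \<le> d" using m by (simp add: moves_iff guard_delays_def)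
  moreover have "\<bar>w $ c - v $ c\<bar> < 2 * dist v w" for c
    using vw[of c] False by (smt (verit) zero_less_dist_iff)
  ultimately obtain e where e: "0 \<le> e" "\<bar>d - e\<bar> < 2 * dist v w"
    "\<And>C. satisfies (delay w d) C \<longleftrightarrow> satisfies (delay v e) C" using region_delay by blast
  have "\<bar>after (e, t) v $ c - after (d, t) w $ c\<bar> \<le> 3 * dist v w" for c
    using e(2) vw[of c] zero_le_dist[of v w] unfolding after_component by (auto simp del: zero_le_dist)
  then have "dist (after (e, t) v) (after (d, t) w) \<le> CARD('c) * (3 * dist v w)" by (rule dist_vec_le)
  moreover have "(e, t) \<in> moves K (l, v)" using m e by (simp add: moves_iff guard_delays_def)
  ultimately show ?thesis using that by (simp add: algebra_simps)
qed

text \<open>Stated in the extended reals, so that it also says that \<infinity> at one point of a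
  region forces \<infinity> at every other.\<close>

definition opt_lipschitz :: "nat \<Rightarrow> real \<Rightarrow> bool" where
  "opt_lipschitz k L \<longleftrightarrow> 0 \<le> L \<and>
     (\<forall>l\<in>locs K. \<forall>v\<in>reg K l. \<forall>w\<in>reg K l. opt K k l v \<le> opt K k l w + ereal (L * dist v w))"

lemma exists_goal_lipschitz:
  obtains L where "0 \<le> L"
    "\<And>l v w. l \<in> goals K \<Longrightarrow> v \<in> reg K l \<Longrightarrow> w \<in> reg K l \<Longrightarrow> w_out K l v \<le> w_out K l w + L * dist v w"
proof -
  have gl: "goals K \<subseteq> locs K" "finite (goals K)"
    using is_wtg[OF kernel] unfolding is_wtg_def locs_def by (auto intro: finite_subset)
  have "\<exists>L\<ge>0. \<forall>v\<in>reg K l. \<forall>w\<in>reg K l. w_out K l v \<le> w_out K l w + L * dist v w" if "l \<in> goals K" for l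
  proof -
    have pl: "continuous_piecewise_linear_on (reg K l) (w_out K l)"
      using kernel that unfolding kernel_wtg_def by blast
    have cv: "convex (reg K l)" using clock_region_convex reg_region[OF kernel] gl that by blast
    obtain G where G: "finite G" "\<And>g. g \<in> G \<Longrightarrow> affine_fn g" "selection (reg K l) G (w_out K l)"
      using piecewise_linear_imp_selection[OF pl] by blast
    show ?thesis using selection_lipschitz[OF cv G] by metis
  qed
  then obtain M where M: "\<And>l. l \<in> goals K \<Longrightarrow> 0 \<le> M l \<and>
      (\<forall>v\<in>reg K l. \<forall>w\<in>reg K l. w_out K l v \<le> w_out K l w + M l * dist v w)" by metis
  show ?thesis
  proof (rule that[of "sum M (goals K)"])
    show "0 \<le> sum M (goals K)" using M by (auto intro: sum_nonneg)
    fix l v w assume l: "l \<in> goals K" "v \<in> reg K l" "w \<in> reg K l"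
    have "M l \<le> sum M (goals K)" using M gl l by (intro member_le_sum) auto
    then have "M l * dist v w \<le> sum M (goals K) * dist v w" by (intro mult_right_mono) auto
    moreover have "w_out K l v \<le> w_out K l w + M l * dist v w" using M l by blast
    ultimately show "w_out K l v \<le> w_out K l w + sum M (goals K) * dist v w" by linarith
  qed
qed

text \<open>Matching moves expand distances by a fixed factor, so the constant is multiplied by that
  factor in each iteration. Uniformity in \<open>k\<close> is not claimed.\<close>

lemma exists_opt_lipschitz: "\<exists>L. opt_lipschitz k L"
proof (induction k)
  case 0
  obtain L where "0 \<le> L" "\<And>l v w. l \<in> goals K \<Longrightarrow> v \<in> reg K l \<Longrightarrow> w \<in> reg K l \<Longrightarrow>
      w_out K l v \<le> w_out K l w + L * dist v w"
    using exists_goal_lipschitz by blast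
  then show ?case unfolding opt_lipschitz_def by (intro exI[of _ L]) auto
next
  case (Suc k)
  then obtain L where L: "0 \<le> L" "\<And>l v w. l \<in> locs K \<Longrightarrow> v \<in> reg K l \<Longrightarrow> w \<in> reg K l \<Longrightarrow>
      opt K k l v \<le> opt K k l w + ereal (L * dist v w)" unfolding opt_lipschitz_def by blast
  define L' where "L' = L * (CARD('c) * 3)"
  have "1 \<le> real CARD('c)" by (simp add: Suc_leI)
  then have "1 \<le> real CARD('c) * 3" by linarith
  then have L': "L \<le> L'" using mult_left_mono[OF _ L(1)] unfolding L'_def by fastforce
  have "opt K (Suc k) l v \<le> opt K (Suc k) l w + ereal (L' * dist v w)"
    if l: "l \<in> locs K" "v \<in> reg K l" "w \<in> reg K l" for l v w
  proof (cases "l \<in> goals K")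
    case True
    have "L * dist v w \<le> L' * dist v w" using L' by (intro mult_right_mono) auto
    then show ?thesis using L(2)[OF l] True by simp
  next
    case False
    have *: "\<exists>n\<in>moves K (l, x). opt K k (target (snd n)) (after n x)
          \<le> opt K k (target (snd m)) (after m y) + ereal (L' * dist v w)
        \<and> opt K k (target (snd m)) (after m y)
          \<le> opt K k (target (snd n)) (after n x) + ereal (L' * dist v w)"
      if xy: "x \<in> reg K l" "y \<in> reg K l" "dist x y = dist v w" and m: "m \<in> moves K (l, y)" for x y m
    proof -
      obtain d t where dt: "m = (d, t)" by fastforce
      obtain e where e: "(e, t) \<in> moves K (l, x)"
        "dist (after (e, t) x) (after (d, t) y) \<le> CARD('c) * 3 * dist x y"
        using moves_match[OF l(1) xy(1,2)] m dt by blast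
      have D: "L * dist (after (e, t) x) (after (d, t) y) \<le> L' * dist v w"
        using mult_left_mono[OF e(2) L(1)] xy(3) unfolding L'_def by (simp add: algebra_simps)
      note ex = moves_reg[OF kernel l(1) xy(1) e(1), simplified]
      note dy = moves_reg[OF kernel l(1) xy(2) m[unfolded dt], simplified]
      have "opt K k (target t) (after (e, t) x) \<le> opt K k (target t) (after (d, t) y) + ereal (L' * dist v w)"
        using L(2)[OF ex dy(2)] D by (meson add_left_mono ereal_less_eq(3) order_trans)
      moreover have "opt K k (target t) (after (d, t) y) \<le> opt K k (target t) (after (e, t) x) + ereal (L' * dist v w)"
        using L(2)[OF dy ex(2)] D[unfolded dist_commute[of "after (e, t) x"]]
        by (meson add_left_mono ereal_less_eq(3) order_trans)
      ultimately show ?thesis using e(1) dt by (intro bexI[of _ "(e, t)"]) auto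
    qed
    show ?thesis
    proof (cases "l \<in> min_locs K")
      case True
      let ?f = "\<lambda>m x. opt K k (target (snd m)) (after m x)"
      have "(INF m\<in>moves K (l, v). ?f m v) - ereal (L' * dist v w) \<le> (INF m\<in>moves K (l, w). ?f m w)"
      proof (rule INF_greatest)
        fix m assume "m \<in> moves K (l, w)"
        then obtain n where n: "n \<in> moves K (l, v)" "?f n v \<le> ?f m w + ereal (L' * dist v w)"
          using *[of v w m] l by blast
        have "(INF m\<in>moves K (l, v). ?f m v) \<le> ?f n v" using n(1) by (rule INF_lower)
        then have "(INF m\<in>moves K (l, v). ?f m v) \<le> ?f m w + ereal (L' * dist v w)" using n(2) by (rule order_trans)
        then show "(INF m\<in>moves K (l, v). ?f m v) - ereal (L' * dist v w) \<le> ?f m w"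
          by (subst ereal_minus_le) auto
      qed
      then have "(INF m\<in>moves K (l, v). ?f m v) \<le> (INF m\<in>moves K (l, w). ?f m w) + ereal (L' * dist v w)"
        by (subst (asm) ereal_minus_le) auto
      then show ?thesis using True False by simp
    next
      case max: False
      let ?f = "\<lambda>m x. opt K k (target (snd m)) (after m x)"
      have "(SUP m\<in>moves K (l, v). ?f m v) \<le> (SUP m\<in>moves K (l, w). ?f m w) + ereal (L' * dist v w)"
      proof (rule SUP_least)
        fix m assume "m \<in> moves K (l, v)"
        then obtain n where n: "n \<in> moves K (l, w)" "?f m v \<le> ?f n w + ereal (L' * dist v w)"
          using *[of w v m] l by (auto simp: dist_commute)
        have "?f n w \<le> (SUP m\<in>moves K (l, w). ?f m w)" using n(1) by (rule SUP_upper)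
        then show "?f m v \<le> (SUP m\<in>moves K (l, w). ?f m w) + ereal (L' * dist v w)"
          using n(2) by (meson add_right_mono order_trans)
      qed
      then show ?thesis using max False by simp
    qed
  qed
  then show ?case using L(1) L' unfolding opt_lipschitz_def by (intro exI[of _ L']) auto
qed

lemma opt_infinity_reg:
  assumes "l \<in> locs K" "v \<in> reg K l" "w \<in> reg K l" "opt K k l v = \<infinity>"
  shows "opt K k l w = \<infinity>"
proof -
  obtain L where "opt_lipschitz k L" using exists_opt_lipschitz by blast
  then have "opt K k l v \<le> opt K k l w + ereal (L * dist v w)" using assms unfolding opt_lipschitz_def by blast
  then show ?thesis using assms(4) by (cases "opt K k l w") auto
qed

lemma opt_real_lipschitz:
  assumes "l \<in> locs K" "\<And>v. v \<in> reg K l \<Longrightarrow> \<exists>y. opt K k l v = ereal y"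
  obtains L where "L-lipschitz_on (reg K l) (\<lambda>v. real_of_ereal (opt K k l v))"
proof -
  obtain L where L: "0 \<le> L" "\<And>v w. v \<in> reg K l \<Longrightarrow> w \<in> reg K l \<Longrightarrow>
      opt K k l v \<le> opt K k l w + ereal (L * dist v w)"
    using exists_opt_lipschitz assms(1) unfolding opt_lipschitz_def by blast
  have *: "real_of_ereal (opt K k l v) \<le> real_of_ereal (opt K k l w) + L * dist v w"
    if "v \<in> reg K l" "w \<in> reg K l" for v w
    using L(2)[OF that] assms(2)[OF that(1)] assms(2)[OF that(2)]
    by (cases "opt K k l v"; cases "opt K k l w") auto
  have "L-lipschitz_on (reg K l) (\<lambda>v. real_of_ereal (opt K k l v))"
  proof (rule lipschitz_onI[OF _ L(1)])
    fix v w assume "v \<in> reg K l" "w \<in> reg K l"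
    then show "dist (real_of_ereal (opt K k l v)) (real_of_ereal (opt K k l w)) \<le> L * dist v w"
      using *[of v w] *[of w v] by (auto simp: dist_real_def abs_le_iff dist_commute)
  qed
  then show ?thesis using that by blast
qed

section \<open>Invariance of the candidates and stabilization\<close>

context
  fixes H :: "'l \<Rightarrow> ('c valuation \<Rightarrow> real) set" and G U
  assumes card: "CARD('c) = 2"
    and live: "\<And>l v. l \<in> locs K \<Longrightarrow> v \<in> reg K l \<Longrightarrow> l \<notin> goals K \<Longrightarrow> moves K (l, v) \<noteq> {}"
    and family: "value_family K H G U"
begin

lemma family_H: "l \<in> goals K \<Longrightarrow> finite (H l)" "l \<in> goals K \<Longrightarrow> g \<in> H l \<Longrightarrow> affine_fn g"
    "l \<in> goals K \<Longrightarrow> selection (reg K l) (H l) (w_out K l)"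
  and family_G: "finite G" "g \<in> G \<Longrightarrow> affine_fn g" "l \<in> goals K \<Longrightarrow> H l \<subseteq> G"
    "l \<in> goals K \<Longrightarrow> diagonal_crossings (H l) G"
  and family_U: "finite U" "u \<in> U \<Longrightarrow> affine_fn u" "boundary_closed G U"
  using family unfolding value_family_def by blast+

lemma reg_unit_cube: "l \<in> locs K \<Longrightarrow> v \<in> reg K l \<Longrightarrow> v \<in> unit_cube"
  using reg_unit[OF kernel] unfolding unit_cube_def by blast

text \<open>The invariant for one transition and either player. Cases: all clocks reset, exactly
  one, none. Only in the last does the kind of target matter, since a goal function need not be
  monotone along delays.\<close>

lemma transition_extremum:
  fixes k l v t
  defines "D \<equiv> guard_delays v (guard t)"
    and "f \<equiv> (\<lambda>d. real_of_ereal (opt K k (target t) (after (d, t) v)))"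
  assumes l: "l \<in> locs K" "l \<notin> goals K" "v \<in> reg K l" and t: "t \<in> transitions K" "source t = l" "D \<noteq> {}"
    and fin: "\<And>w. w \<in> reg K (target t) \<Longrightarrow> \<exists>y\<in>cands G U w. opt K k (target t) w = ereal y"
    and m: "is_extremum D f m"
  shows "m \<in> cands G U v"
proof -
  have move: "(d, t) \<in> moves K (l, v)" if "d \<in> D" for d
    using that l t unfolding D_def by (simp add: moves_iff)
  have tl: "target t \<in> locs K" using t is_wtg[OF kernel] unfolding is_wtg_def by blast
  have succ: "after (d, t) v \<in> reg K (target t)" if "d \<in> D" for d
    using moves_reg(2)[OF kernel l(1,3) move[OF that]] by simp
  have succ_unit: "after (d, t) v \<in> unit_cube" if "d \<in> D" for d
    using reg_unit_cube[OF tl succ[OF that]] .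
  have fc: "f d \<in> cands G U (after (d, t) v)" if "d \<in> D" for d
    using fin[OF succ[OF that]] unfolding f_def by auto
  have opt_f: "opt K k (target t) (after (d, t) v) = ereal (f d)" if "d \<in> D" for d
    using fin[OF succ[OF that]] unfolding f_def by auto
  have cf: "continuous_on D f"
  proof -
    obtain L where "L-lipschitz_on (reg K (target t)) (\<lambda>v. real_of_ereal (opt K k (target t) v))"
      using opt_real_lipschitz[OF tl] fin by blast
    then have "continuous_on (reg K (target t)) (\<lambda>v. real_of_ereal (opt K k (target t) v))"
      by (rule lipschitz_on_continuous_on)
    moreover have "continuous_on D (\<lambda>d. after (d, t) v)"
    proof -
      have "continuous_on D (\<lambda>d. if c \<in> resets t then 0 else v $ c + d)" for c
        by (cases "c \<in> resets t") (auto intro!: continuous_intros)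
      then have "continuous_on D (\<lambda>d. \<chi> c. if c \<in> resets t then 0 else v $ c + d)"
        by (rule continuous_on_vec_lambda)
      moreover have "after (d, t) v = (\<chi> c. if c \<in> resets t then 0 else v $ c + d)" for d
        by (simp add: vec_eq_iff after_component)
      ultimately show ?thesis by simp
    qed
    ultimately show ?thesis unfolding f_def by (rule continuous_on_compose2) (use succ in blast)
  qed
  show ?thesis
  proof (cases "resets t = UNIV")
    case True
    \<comment> \<open>Every successor is the origin, where each candidate is some
      \<open>u 0\<close>, stored in \<open>U\<close> as a constant.\<close>
    have "after (d, t) v = edge_point z 0 0" for d z
      using True by (simp add: vec_eq_iff after_component edge_point_def)
    then obtain z where a: "\<And>d. after (d, t) v = edge_point z 0 0" by blast
    obtain d where d: "d \<in> D" using t(3) by blast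
    have "m = f d"
      by (rule is_extremum_const[OF m _ t(3)]) (simp add: f_def a)
    then have "m \<in> {u 0 | u. u \<in> U}"
      using fc[OF d] cands_edge_point[OF family_U(3), of 0 z] a by auto
    then obtain u where "u \<in> U" "m = u 0" by blast
    then have "(\<lambda>_. m) \<in> U" using family_U(3) unfolding boundary_closed_def by auto
    then show ?thesis by (rule cands_const)
  next
    case False
    then obtain z where z: "z \<notin> resets t" by blast
    \<comment> \<open>A clock that is not reset stays at most 1 in the target region and so bounds
      the delays.\<close>
    have "d \<le> 1" if "d \<in> D" for d
    proof -
      have "v $ z + d \<le> 1" using succ_unit[OF that] z unfolding unit_cube_def
        by (metis (mono_tags, lifting) after_component mem_Collect_eq)
      moreover have "0 \<le> v $ z" using reg_unit[OF kernel l(1,3)] by blast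
      ultimately show ?thesis by linarith
    qed
    then have "bdd_above D" by (auto simp: bdd_above_def)
    then obtain p q where pq: "0 \<le> p" "D \<subseteq> {p..q}" "{p<..<q} \<subseteq> D" "p \<in> closure D" "q \<in> closure D"
      "event v p" "event v q" using guard_delays_interval t(3) unfolding D_def by metis
    have z01: "0 \<le> v $ z + c \<and> v $ z + c \<le> 1" if "c \<in> closure D" for c
    proof -
      have "D \<subseteq> {- (v $ z)..1 - v $ z}"
      proof
        fix d assume "d \<in> D"
        then have "0 \<le> after (d, t) v $ z \<and> after (d, t) v $ z \<le> 1"
          using succ_unit unfolding unit_cube_def by blast
        then show "d \<in> {- (v $ z)..1 - v $ z}" using z by (simp add: after_component)
      qed
      then have "closure D \<subseteq> {- (v $ z)..1 - v $ z}" by (rule closure_minimal) simp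
      then show ?thesis using that by auto
    qed
    have zpar: "v $ z + c \<in> params v" if "event v c" "c \<in> closure D" for c
    proof -
      have "v $ z + c \<in> params (delay v c)"
        using z01[OF that(2)] unfolding params_def delay_def by (auto intro!: exI[of _ 0])
      then show ?thesis using params_delay[OF that(1)] by blast
    qed
    show ?thesis
    proof (cases "resets t = {}")
      case False
      then obtain x where x: "x \<in> resets t" by blast
      then have xz: "x \<noteq> z" using z by blast
      have a: "after (d, t) v = edge_point x 0 (v $ z + d)" for d
      proof (subst vec_eq_iff, rule allI)
        fix c
        show "after (d, t) v $ c = edge_point x 0 (v $ z + d) $ c"
          using two_clocks[OF card xz, of c] x z xz by (auto simp: after_component edge_point_def)
      qed
      \<comment> \<open>The surviving coordinate is \<open>v $ z + d\<close>, so \<open>f\<close>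
        selects among translates of \<open>U\<close>. Translation preserves crossing values, which
        \<open>U\<close> holds as constants, and the end values are taken at parameters of
        \<open>v\<close>.\<close>
      let ?U = "(\<lambda>u d. u (v $ z + d)) ` U"
      have aff: "affine_fn u" if u: "u \<in> ?U" for u
      proof -
        obtain u' where u': "u' \<in> U" "u = (\<lambda>d. u' (v $ z + d))" using u by blast
        have "affine_fn (\<lambda>d::real. v $ z + d)" unfolding affine_fn_def by (intro exI[of _ 1] exI[of _ "v $ z"]) simp
        then show ?thesis unfolding u'(2) by (rule affine_fn_compose[OF family_U(2)[OF u'(1)]])
      qed
      have "f d \<in> {u (v $ z + d) | u. u \<in> U}" if "d \<in> D" for d
        using fc[OF that] cands_edge_point[OF family_U(3), of "v $ z + d" x] z01[of d] that closure_subset unfolding a by blast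
      then have "\<exists>u\<in>?U. f d = u d" if "d \<in> D" for d using that by fastforce
      then have sel: "selection D ?U f" unfolding selection_def using cf by blast
      have "(\<exists>u\<in>?U. m = u p \<or> m = u q) \<or> (\<exists>u\<in>?U. \<exists>w\<in>?U. \<exists>s. u \<noteq> w \<and> u s = m \<and> w s = m)"
        by (rule selection_extremum[OF _ aff sel pq(2,3) m]) (use family_U(1) in auto)
      then consider u where "u \<in> U" "m = u (v $ z + p) \<or> m = u (v $ z + q)"
        | u w s where "u \<in> U" "w \<in> U" "u \<noteq> w" "u (v $ z + s) = m" "w (v $ z + s) = m" by blast
      then show ?thesis
      proof cases
        case 1
        then show ?thesis using zpar[OF pq(6,4)] zpar[OF pq(7,5)] cands_param by metis
      next
        case 2
        then have "(\<lambda>_. m) \<in> U" using family_U(3) unfolding boundary_closed_def by metis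
        then show ?thesis by (rule cands_const)
      qed
    next
      case True
      have a: "after (d, t) v = delay v d" for d
        using True by (simp add: vec_eq_iff after_component delay_def)
      have D: "delay v d \<in> unit_cube \<and> f d \<in> cands G U (delay v d)" if "d \<in> D" for d
        using succ_unit[OF that] fc[OF that] unfolding a by blast
      have unit: "delay v c \<in> unit_cube" if "c \<in> closure D" for c
      proof -
        have "closed {c. delay v c \<in> unit_cube}"
          unfolding unit_cube_def delay_def
          by (auto intro!: closed_Collect_all closed_Collect_conj closed_Collect_le continuous_intros)
        then have "closure D \<subseteq> {c. delay v c \<in> unit_cube}" using D by (intro closure_minimal) auto
        then show ?thesis using that by blast
      qed
      have sub: "cands G U (delay v c) \<subseteq> cands G U v" if "c \<in> {p, q}" for c
        using cands_delay[OF card family_U(3)] pq(4-7) unit that by blast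
      show ?thesis
      proof (cases "target t \<in> goals K")
        case False
        \<comment> \<open>The extremum is a limit at \<open>p\<close> or \<open>q\<close>, both
          events, and \<open>sub\<close> pulls the candidates found there back to
          \<open>v\<close>.\<close>
        have mono: "(\<forall>s\<in>D. \<forall>r\<in>D. s \<le> r \<longrightarrow> f s \<le> f r) \<or> (\<forall>s\<in>D. \<forall>r\<in>D. s \<le> r \<longrightarrow> f r \<le> f s)"
        proof (cases "target t \<in> min_locs K")
          case True
          have "f s \<le> f r" if "s \<in> D" "r \<in> D" "s \<le> r" for s r
            using opt_delay_min[OF True False, of "r - s" k "delay v s"] that opt_f[of s] opt_f[of r]
            unfolding a by simp
          then show ?thesis by blast
        next
          case max: False
          have "f r \<le> f s" if "s \<in> D" "r \<in> D" "s \<le> r" for s r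
            using opt_delay_max[OF max False, of "r - s" k "delay v s"] that opt_f[of s] opt_f[of r]
            unfolding a by simp
          then show ?thesis by blast
        qed
        obtain c where c: "c \<in> {p, q}" "\<And>e. e > 0 \<Longrightarrow> \<exists>d\<in>D. \<bar>d - c\<bar> < e \<and> \<bar>f d - m\<bar> < e"
          using monotone_extremum[OF mono pq(2,4,5) m] by blast
        have "m \<in> cands G U (delay v c)" by (rule cands_limit(2)[OF family_G(1,2) family_U(1,2) D c(2)])
        then show ?thesis using sub[OF c(1)] by blast
      next
        case True
        \<comment> \<open>Working with the pieces of this goal instead of all candidates at the
          successor is why \<open>G\<close> needs no further crossings.\<close>
        let ?H = "(\<lambda>g d. g (delay v d)) ` H (target t)"
        have aff: "affine_fn u" if "u \<in> ?H" for u
          using that family_H(2)[OF True] affine_fn_delay by auto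
        have "f d = w_out K (target t) (delay v d)" for d unfolding f_def a using True by simp
        then have "\<exists>u\<in>?H. f d = u d" if "d \<in> D" for d
          using family_H(3)[OF True] succ[OF that] unfolding selection_def a by auto
        then have sel: "selection D ?H f" unfolding selection_def using cf by blast
        have "(\<exists>u\<in>?H. m = u p \<or> m = u q) \<or> (\<exists>u\<in>?H. \<exists>w\<in>?H. \<exists>s. u \<noteq> w \<and> u s = m \<and> w s = m)"
          by (rule selection_extremum[OF _ aff sel pq(2,3) m]) (use family_H(1)[OF True] in auto)
        then consider g where "g \<in> H (target t)" "m = g (delay v p) \<or> m = g (delay v q)"
          | g h s where "g \<in> H (target t)" "h \<in> H (target t)" "(\<lambda>d. g (delay v d)) \<noteq> (\<lambda>d. h (delay v d))"
             "g (delay v s) = m" "h (delay v s) = m" by blast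
        then show ?thesis
        proof cases
          case 1
          then have "g \<in> G" using family_G(3)[OF True] by blast
          then show ?thesis using cands_fn[of g G _ U] sub[of p] sub[of q] 1(2) by blast
        next
          case 2
          then have "g (delay v s) = h (delay v s)" by simp
          from diagonal_crossingsD[OF family_G(4)[OF True] 2(1-3) this]
          obtain h' where "h' \<in> G" "h' v = m" unfolding 2(4) by blast
          then show ?thesis using cands_fn by blast
        qed
      qed
    qed
  qed
qed

text \<open>There are finitely many enabled transitions, and by \<open>live\<close> at least one, so
  the outer infimum or supremum is the contribution of a single transition and -\<infinity> never
  occurs.\<close>

lemma opt_cands:
  assumes "l \<in> locs K" "v \<in> reg K l"
  shows "opt K k l v = \<infinity> \<or> (\<exists>y\<in>cands G U v. opt K k l v = ereal y)"
  using assms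
proof (induction k arbitrary: l v)
  case 0
  have "w_out K l v \<in> cands G U v" if "l \<in> goals K"
    using family_H(3)[OF that] family_G(3)[OF that] 0 cands_fn unfolding selection_def by (metis subsetD)
  then show ?case by auto
next
  case (Suc k)
  show ?case
  proof (cases "l \<in> goals K")
    case True
    then have "w_out K l v \<in> cands G U v"
      using family_H(3)[OF True] family_G(3)[OF True] Suc.prems cands_fn unfolding selection_def by (metis subsetD)
    then show ?thesis using True by auto
  next
    case False
    define D where "D t = guard_delays v (guard t)" for t :: "('l, 'c) transition"
    define T where "T = {t \<in> transitions K. source t = l \<and> D t \<noteq> {}}"
    let ?F = "\<lambda>d t. opt K k (target t) (after (d, t) v)"
    have moves: "moves K (l, v) = (\<Union>t\<in>T. (\<lambda>d. (d, t)) ` D t)"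
      using False unfolding T_def D_def by (auto simp: moves_iff)
    have T: "finite T" "T \<noteq> {}"
      using is_wtg[OF kernel] live[OF Suc.prems False] moves unfolding is_wtg_def T_def by auto
    have ext: "((INF d\<in>D t. ?F d t) = \<infinity> \<or> (\<exists>y\<in>cands G U v. (INF d\<in>D t. ?F d t) = ereal y)) \<and>
        ((SUP d\<in>D t. ?F d t) = \<infinity> \<or> (\<exists>y\<in>cands G U v. (SUP d\<in>D t. ?F d t) = ereal y))" if t: "t \<in> T" for t
    proof -
      have tl: "target t \<in> locs K" using t is_wtg[OF kernel] unfolding is_wtg_def T_def by blast
      have succ: "after (d, t) v \<in> reg K (target t)" if "d \<in> D t" for d
        using moves_reg(2)[OF kernel Suc.prems, of "(d, t)"] that t moves by auto
      have ne: "D t \<noteq> {}" using t unfolding T_def by blast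
      show ?thesis
      \<comment> \<open>The target iterate is \<infinity> on its whole region or nowhere on it, so a
        transition contributes only \<infinity> or a real function of the delay.\<close>
      proof (cases "\<exists>w\<in>reg K (target t). opt K k (target t) w = \<infinity>")
        case True
        then have "?F d t = \<infinity>" if "d \<in> D t" for d
          using opt_infinity_reg[OF tl] succ[OF that] by blast
        then show ?thesis using ne by (simp add: top_ereal_def[symmetric])
      next
        case nf: False
        then have fin: "\<exists>y\<in>cands G U w. opt K k (target t) w = ereal y" if "w \<in> reg K (target t)" for w
          using Suc.IH[OF tl that] that by blast
        define f where "f d = real_of_ereal (?F d t)" for d
        have Ff: "?F d t = ereal (f d)" if "d \<in> D t" for d
          using fin[OF succ[OF that]] unfolding f_def by auto
        obtain L where L: "L-lipschitz_on (reg K (target t)) (\<lambda>v. real_of_ereal (opt K k (target t) v))"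
          using opt_real_lipschitz[OF tl] fin by blast
        obtain d0 where d0: "d0 \<in> D t" using ne by blast
        \<comment> \<open>Successors lie in the unit cube, so the Lipschitz bound makes
          \<open>f\<close> bounded and its extrema real.\<close>
        have "dist (f d) (f d0) \<le> L * CARD('c)" if "d \<in> D t" for d
        proof -
          have "\<bar>after (d, t) v $ c - after (d0, t) v $ c\<bar> \<le> 1" for c
            using reg_unit[OF kernel tl succ[OF that], of c] reg_unit[OF kernel tl succ[OF d0], of c] by (simp add: abs_le_iff)
          then have "dist (after (d, t) v) (after (d0, t) v) \<le> real CARD('c) * 1" by (rule dist_vec_le)
          then have "L * dist (after (d, t) v) (after (d0, t) v) \<le> L * CARD('c)"
            using lipschitz_on_nonneg[OF L] by (intro mult_left_mono) auto
          then show ?thesis using lipschitz_onD[OF L succ[OF that] succ[OF d0]] unfolding f_def by linarith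
        qed
        then have b: "f d0 - L * CARD('c) \<le> f d" "f d \<le> f d0 + L * CARD('c)" if "d \<in> D t" for d
          using that by (auto simp: dist_real_def abs_le_iff algebra_simps dest!: spec)
        have extr: "y \<in> cands G U v" if "is_extremum (D t) f y" for y
          using transition_extremum[OF Suc.prems(1) False Suc.prems(2) _ _ _ fin] that t unfolding T_def D_def f_def by blast
        obtain y where "(INF d\<in>D t. ereal (f d)) = ereal y" "is_extremum (D t) f y"
          by (rule INF_is_extremum[where f = f, OF ne]) (use b(1) in blast)+
        moreover obtain y' where "(SUP d\<in>D t. ereal (f d)) = ereal y'" "is_extremum (D t) f y'"
          by (rule SUP_is_extremum[where f = f, OF ne]) (use b(2) in blast)+
        moreover have "(INF d\<in>D t. ?F d t) = (INF d\<in>D t. ereal (f d))" using Ff by (intro INF_cong) auto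
        moreover have "(SUP d\<in>D t. ?F d t) = (SUP d\<in>D t. ereal (f d))" using Ff by (intro SUP_cong) auto
        ultimately show ?thesis using extr by auto
      qed
    qed
    show ?thesis
    proof (cases "l \<in> min_locs K")
      case True
      let ?c = "\<lambda>t. INF d\<in>D t. ?F d t"
      have "opt K (Suc k) l v = (INF t\<in>T. ?c t)"
        using True False by (simp add: moves INF_UN image_image)
      also have "\<dots> = Min (?c ` T)" using T by (subst Min_Inf) auto
      also have "\<dots> \<in> ?c ` T" using T by (intro Min_in) auto
      finally obtain t where "t \<in> T" "opt K (Suc k) l v = ?c t" by blast
      then show ?thesis using ext by metis
    next
      case max: False
      let ?c = "\<lambda>t. SUP d\<in>D t. ?F d t"
      have "opt K (Suc k) l v = (SUP t\<in>T. ?c t)"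
        using max False by (simp add: moves SUP_UNION image_image)
      also have "\<dots> = Max (?c ` T)" using T by (subst Max_Sup) auto
      also have "\<dots> \<in> ?c ` T" using T by (intro Max_in) auto
      finally obtain t where "t \<in> T" "opt K (Suc k) l v = ?c t" by blast
      then show ?thesis using ext by metis
    qed
  qed
qed

lemma opt_selection:
  assumes l: "l \<in> locs K" and fin: "\<And>v. v \<in> reg K l \<Longrightarrow> opt K k l v \<noteq> \<infinity>"
  shows "selection (reg K l) (cand_fns G U) (\<lambda>v. real_of_ereal (opt K k l v))"
proof -
  have c: "\<exists>y\<in>cands G U v. opt K k l v = ereal y" if "v \<in> reg K l" for v
    using opt_cands[OF l that] fin[OF that] by blast
  obtain L where "L-lipschitz_on (reg K l) (\<lambda>v. real_of_ereal (opt K k l v))"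
    using opt_real_lipschitz[OF l] c by blast
  moreover have "\<exists>g\<in>cand_fns G U. real_of_ereal (opt K k l v) = g v" if "v \<in> reg K l" for v
    using c[OF that] cands_cand_fns[OF reg_unit_cube[OF l that]] by force
  ultimately show ?thesis unfolding selection_def using lipschitz_on_continuous_on by blast
qed

lemma finite_cand_selections:
  assumes "l \<in> locs K"
  shows "finite {restrict f (reg K l) | f. selection (reg K l) (cand_fns G U) f}"
  using finite_selections[OF clock_region_convex[OF reg_region[OF kernel assms]] finite_cand_fns[OF family_G(1) family_U(1)]]
    affine_cand_fns[OF family_G(2) family_U(2)] by blast

lemma exists_stable: "\<exists>k. value_iteration_stable K k"
proof -
  \<comment> \<open>The inserted function stands for an iterate that is \<infinity> on the whole
    region; \<open>S k\<close> records all locations at once, for the pigeonhole principle.\<close>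
  define F where "F l = insert (restrict (\<lambda>_. \<infinity>) (reg K l))
     ((\<lambda>f. restrict (\<lambda>v. ereal (f v)) (reg K l)) ` {restrict f (reg K l) | f. selection (reg K l) (cand_fns G U) f})" for l
  define S where "S k = restrict (\<lambda>l. restrict (opt K k l) (reg K l)) (locs K)" for k
  have "finite (F l)" if "l \<in> locs K" for l
    unfolding F_def using finite_cand_selections[OF that] by blast
  moreover have "finite (locs K)" using is_wtg[OF kernel] unfolding is_wtg_def locs_def by blast
  ultimately have "finite (PiE (locs K) F)" by (intro finite_PiE) auto
  moreover have "S k \<in> PiE (locs K) F" for k
  proof -
    have "restrict (opt K k l) (reg K l) \<in> F l" if l: "l \<in> locs K" for l
    proof (cases "\<exists>v\<in>reg K l. opt K k l v = \<infinity>")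
      case True
      then have "opt K k l v = \<infinity>" if "v \<in> reg K l" for v using opt_infinity_reg[OF l] that by blast
      then have "restrict (opt K k l) (reg K l) = restrict (\<lambda>_. \<infinity>) (reg K l)" by (intro restrict_ext)
      then show ?thesis unfolding F_def by blast
    next
      case False
      let ?f = "\<lambda>v. real_of_ereal (opt K k l v)"
      have "selection (reg K l) (cand_fns G U) ?f" using opt_selection[OF l] False by blast
      moreover have "restrict (opt K k l) (reg K l) = restrict (\<lambda>v. ereal (restrict ?f (reg K l) v)) (reg K l)"
      proof (rule restrict_ext)
        fix v assume v: "v \<in> reg K l"
        then show "opt K k l v = ereal (restrict ?f (reg K l) v)" using opt_cands[OF l v, of k] False by auto
      qed
      ultimately show ?thesis unfolding F_def by blast
    qed
    then show ?thesis unfolding S_def by auto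
  qed
  ultimately have "finite (range S)" by (meson finite_subset image_subsetI)
  then have "\<not> inj S" using finite_imageD infinite_UNIV_nat by blast
  then obtain i j where ij: "i < j" "S i = S j" by (metis injI linorder_neqE_nat)
  \<comment> \<open>Since the iterates decrease, a repetition at \<open>i < j\<close> squeezes
    iterate \<open>Suc i\<close> between two equal functions.\<close>
  have "opt K (Suc i) l v = opt K i l v" if l: "l \<in> locs K" "v \<in> reg K l" for l v
  proof (rule antisym)
    have "S i l v = S j l v" using ij by simp
    then have "opt K i l v = opt K j l v" using l by (simp add: S_def)
    also have "\<dots> \<le> opt K (Suc i) l v" using ij by (intro opt_antimono) simp
    finally show "opt K i l v \<le> opt K (Suc i) l v" .
  qed (rule opt_antimono_Suc)
  then show ?thesis unfolding value_iteration_stable_def by blast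
qed

end

lemma exists_value_family: "\<exists>H G U. value_family K H G U"
proof -
  have "\<exists>G. finite G \<and> (\<forall>g\<in>G. affine_fn g) \<and> selection (reg K l) G (w_out K l)" if "l \<in> goals K" for l
  proof -
    have "continuous_piecewise_linear_on (reg K l) (w_out K l)"
      using kernel that unfolding kernel_wtg_def by blast
    then show ?thesis using piecewise_linear_imp_selection by metis
  qed
  then obtain H where H: "\<And>l. l \<in> goals K \<Longrightarrow> finite (H l) \<and> (\<forall>g\<in>H l. affine_fn g) \<and> selection (reg K l) (H l) (w_out K l)"
    by metis
  have "finite (goals K)" using is_wtg[OF kernel] unfolding is_wtg_def by (auto intro: finite_subset)
  then have fin: "finite (\<Union>(H ` goals K))" using H by blast
  have aff: "affine_fn g" if "g \<in> \<Union>(H ` goals K)" for g using H that by blast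
  obtain G where G: "finite G" "\<And>g. g \<in> G \<Longrightarrow> affine_fn g" "\<Union>(H ` goals K) \<subseteq> G"
    "diagonal_crossings (\<Union>(H ` goals K)) G"
    using exists_diagonal_crossings[OF fin aff] by blast
  obtain U where U: "finite U" "\<And>u. u \<in> U \<Longrightarrow> affine_fn u" "boundary_closed G U"
    using exists_boundary_closed[OF G(1,2)] by blast
  have "value_family K H G U"
    unfolding value_family_def
  proof (intro conjI ballI)
    fix l assume "l \<in> goals K"
    then show "diagonal_crossings (H l) G" by (intro diagonal_crossings_subset[OF G(4)]) blast
  qed (use H G(1-3) U in blast)+
  then show ?thesis by blast
qed

end

theorem theorem7:
  fixes K :: "('l, 'c::finite) kernel"
  assumes "kernel_wtg K"
    and "CARD('c) = 2"
    and "\<And>l \<nu>. l \<in> locs K \<Longrightarrow> \<nu> \<in> reg K l \<Longrightarrow> \<bar>Val K l \<nu>\<bar> \<noteq> \<infinity>"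
  shows "(\<forall>i \<in> locs K. continuous_piecewise_linear_on (reg K i) (\<lambda>\<nu>. real_of_ereal (Val K i \<nu>))) \<and>
         (\<exists>k. value_iteration_stable K k) \<and>
         (\<forall>k. value_iteration_stable K k \<longrightarrow>
            (\<forall>i \<in> locs K. \<forall>\<nu> \<in> reg K i. opt K k i \<nu> = Val K i \<nu>))"
proof -
  have live: "moves K (l, v) \<noteq> {}" if "l \<in> locs K" "v \<in> reg K l" "l \<notin> goals K" for l v
    using moves_nonempty[OF assms(1) that assms(3)[OF that(1,2)]] .
  obtain H G U where fam: "value_family K H G U"
    using exists_value_family[OF assms(1)] by blast
  \<comment> \<open>The upper bound on the value holds for every index; stability is needed only for
    the lower bound.\<close>
  have eq: "opt K k i v = Val K i v" if "value_iteration_stable K k" "i \<in> locs K" "v \<in> reg K i" for k i v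
    using Val_le_opt[OF assms(1) live that(2,3), of k] opt_le_Val[OF assms(1) that] by (rule antisym[rotated])
  obtain k where k: "value_iteration_stable K k"
    using exists_stable[OF assms(1,2) live fam] by blast
  have "continuous_piecewise_linear_on (reg K i) (\<lambda>v. real_of_ereal (Val K i v))" if i: "i \<in> locs K" for i
  proof -
    \<comment> \<open>The stable iterate equals the value, which is real, so it is a selection, and
      this transfers to the value.\<close>
    have "opt K k i v \<noteq> \<infinity>" if "v \<in> reg K i" for v
      using eq[OF k i that] assms(3)[OF i that] by auto
    then have "selection (reg K i) (cand_fns G U) (\<lambda>v. real_of_ereal (opt K k i v))"
      by (intro opt_selection[OF assms(1,2) _ fam i]) (use live in blast)+
    then have sel: "selection (reg K i) (cand_fns G U) (\<lambda>v. real_of_ereal (Val K i v))"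
      unfolding selection_def using eq[OF k i] by (simp cong: continuous_on_cong)
    have fam': "finite G" "\<And>g. g \<in> G \<Longrightarrow> affine_fn g" "finite U" "\<And>u. u \<in> U \<Longrightarrow> affine_fn u"
      using fam unfolding value_family_def by blast+
    show ?thesis
      by (rule selection_imp_piecewise_linear[OF clock_region_convex[OF reg_region[OF assms(1) i]]
            finite_cand_fns[OF fam'(1,3)] _ sel])
         (rule affine_cand_fns[OF fam'(2,4)])
  qed
  then show ?thesis using k eq by blast
qed

end
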